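(* Let $N,n,m$ be integers with $0\le m<n$ and $N>2n$, and put $q=n-m$. Let $y\in\mathbb{R}^N$ be given, let $p_1,\dots,p_m\in\mathbb{C}$ be fixed poles such that $c(z)=\prod_{i=1}^m(z-p_i)=z^m+c_1z^{m-1}+\dots+c_m$ has real coefficients, and let $\mathbf{c}=(c_m,\dots,c_1,1)^{\top}\in\mathbb{R}^{m+1}$. Let $\mathbf{e}\in\mathbb{R}^{q+1}$ be a non-zero normalization vector. With $T_k^{\mathbf{v}}$ denoting the banded Toeplitz matrices defined in the context, put, for $\mathbf{b}=(b_q,\dots,b_1,b_0)^{\top}$, $$T_{N-n}^{\mathbf{c}\cdot\mathbf{b}}=T_{N-n}^{\mathbf{c}}\,T_{N-q}^{\mathbf{b}},$$ and consider the $(N-n)\times(N-2n+m+1)$ cubic matrix polynomial in $\mathbf{b}$ $$\mathcal{A}(\mathbf{b})=\begin{bmatrix} T_{N-n}^{\mathbf{c}\cdot\mathbf{b}}\,y & \; T_{N-n}^{\mathbf{c}\cdot\mathbf{b}}\,(T_{N-n}^{\mathbf{c}\cdot\mathbf{b}})^{\top}\,(T_{N-2n+m}^{\mathbf{b}})^{\top}\end{bmatrix}.$$ Consider the associated multiparameter eigenvalue problem $\mathcal{A}(\mathbf{b})\mathbf{z}=\mathbf{0}$, with real affine eigenvalues $\mathbf{b}$ as defined in the context (so normalized by $\mathbf{b}^{\top}\mathbf{e}=1$). Then: (i) every real-valued affine eigenvalue $\mathbf{b}$ corresponds to a critical point of the fixed-pole least squares realization problem $$\min_{\mathbf{b}\in\mathbb{R}^{q+1},\,\hat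 y\in\mathbb{R}^N}\ \tfrac12\|y-\hat y\|_2^2\quad\text{subject to}\quad T_{N-n}^{\mathbf{c}}\,T_{N-q}^{\mathbf{b}}\,\hat y=\mathbf{0},\quad \mathbf{b}^{\top}\mathbf{e}=1,$$ that is, there exist $\hat y\in\mathbb{R}^N$ and Lagrange multipliers $\lambda\in\mathbb{R}^{N-n}$, $\mu\in\mathbb{R}$ such that $(\mathbf{b},\hat y,\lambda,\mu)$ is a critical point of this problem; (ii) the (local) minimizers of this problem are among these eigenvalues: if $(\mathbf{b},\hat y)$ is a (local) minimizer of the problem, then $\mathbf{b}$ is a real-valued affine eigenvalue of $\mathcal{A}(\mathbf{b})\mathbf{z}=\mathbf{0}$.
   Context: **Toeplitz matrices.** For a coefficient vector $\mathbf{v}=(v_d,\dots,v_1,v_0)^{\top}$ of length $d+1$ and an integer $k\ge1$, $T_k^{\mathbf{v}}$ is the $k\times(k+d)$ banded Toeplitz matrix whose $i$-th row ($i=1,\dots,k$) has the entries $v_d,\dots,v_1,v_0$ in columns $i,i+1,\dots,i+d$ and zeros elsewhere. Thus $T_{N-n}^{\mathbf{c}}\in\mathbb{R}^{(N-n)\times(N-q)}$, $T_{N-q}^{\mathbf{b}}$ has size $(N-q)\times N$, and $T_{N-2n+m}^{\mathbf{b}}$ has size $(N-2n+m)\times(N-n)$. The product $T_{N-n}^{\mathbf{c}}T_{N-q}^{\mathbf{b}}$ is the $(N-n)\times N$ Toeplitz matrix of the coefficients of $a(z)=b(z)c(z)$, where $b(z)=b_0z^q+b_1z^{q-1}+\dots+b_q$.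 **Eigenvalues.** A real-valued affine (i.e. finite) eigenvalue of the multiparameter eigenvalue problem $\mathcal{A}(\mathbf{b})\mathbf{z}=\mathbf{0}$ is a vector $\mathbf{b}\in\mathbb{R}^{q+1}$ with $\mathbf{b}^{\top}\mathbf{e}=1$ for which $\mathcal{A}(\mathbf{b})$ does not have full column rank, so that there exists a non-zero $\mathbf{z}\in\mathbb{C}^{N-2n+m+1}$ with $\mathcal{A}(\mathbf{b})\mathbf{z}=\mathbf{0}$. **Critical points.** The Lagrangian of the optimization problem is $$\mathcal{L}(\mathbf{b},\hat y,\lambda,\mu)=\tfrac12\|y-\hat y\|_2^2+\lambda^{\top}T_{N-n}^{\mathbf{c}}T_{N-q}^{\mathbf{b}}\hat y+\mu(\mathbf{b}^{\top}\mathbf{e}-1),\qquad \lambda\in\mathbb{R}^{N-n},\ \mu\in\mathbb{R}.$$ A critical point is a real tuple $(\mathbf{b},\hat y,\lambda,\mu)$ at which all partial derivatives of $\mathcal{L}$ vanish, i.e. $$\hat Y^{\top}(T_{N-n}^{\mathbf{c}})^{\top}\lambda+\mu\,\mathbf{e}=\mathbf{0},\quad \hat y-y+(T_{N-q}^{\mathbf{b}})^{\top}(T_{N-n}^{\mathbf{c}})^{\top}\lambda=\mathbf{0},\quad T_{N-n}^{\mathbf{c}}T_{N-q}^{\mathbf{b}}\hat y=\mathbf{0},\quad \mathbf{b}^{\top}\mathbf{e}=1,$$ where $\hat Y\in\mathbb{R}^{(N-q)\times(q+1)}$ is the Hankel matrix with entries $\hat Y_{ij}=\hat y_{i+j-1}$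 (so that $T_{N-q}^{\mathbf{b}}\hat y=\hat Y\mathbf{b}$). **Local minimizers.** A (local) minimizer is a feasible pair $(\mathbf{b},\hat y)\in\mathbb{R}^{q+1}\times\mathbb{R}^N$ at which the objective attains a local minimum over the feasible set. For $m=0$ one takes $\mathbf{c}=(1)$, so that $T_k^{\mathbf{c}}$ is the identity matrix. *)

theory Defs
  imports
    Complex_Main
    "HOL-Computational_Algebra.Polynomial"
    "Jordan_Normal_Form.DL_Rank"
begin

text \<open>
  A coefficient vector \<open>(v\<^sub>d, \<dots>, v\<^sub>1, v\<^sub>0)\<close> is a vector of dimension \<open>d + 1\<close> listed in exactly this
  order, so the entry with (0-based) index \<open>j\<close> is \<open>v\<^sub>d\<^sub>-\<^sub>j\<close>. All matrix indices are 0-based.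
\<close>

definition toeplitz :: "nat \<Rightarrow> real vec \<Rightarrow> real mat" where
  "toeplitz k v = mat k (k + (dim_vec v - 1))
     (\<lambda>(i, j). if i \<le> j \<and> j < i + dim_vec v then v $ (j - i) else 0)"

definition hankel :: "nat \<Rightarrow> nat \<Rightarrow> real vec \<Rightarrow> real mat" where
  "hankel k l x = mat k l (\<lambda>(i, j). x $ (i + j))"

definition pole_poly :: "nat \<Rightarrow> (nat \<Rightarrow> complex) \<Rightarrow> complex poly" where
  "pole_poly m p = (\<Prod>i=1..m. [:- p i, 1:])"

text \<open>
  The vector \<open>(c\<^sub>m, \<dots>, c\<^sub>1, 1)\<close>: as \<open>c\<^sub>m\<^sub>-\<^sub>j\<close> is the coefficient of \<open>z\<^sup>j\<close> in
  \<open>c(z) = z\<^sup>m + c\<^sub>1 z\<^sup>m\<^sup>-\<^sup>1 + \<dots> + c\<^sub>m\<close>, its entry with index \<open>j\<close> is that coefficient. Taking real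
  parts only changes the type; the coefficients are assumed to be real where this is used.
\<close>

definition pole_coeffs :: "nat \<Rightarrow> (nat \<Rightarrow> complex) \<Rightarrow> real vec" where
  "pole_coeffs m p = vec (m + 1) (\<lambda>j. Re (coeff (pole_poly m p) j))"

text \<open>
  Throughout, \<open>q\<close> is written out as \<open>n - m\<close>, and the vectors \<open>c\<close>, \<open>b\<close> have dimensions \<open>m + 1\<close> and
  \<open>n - m + 1\<close>.
\<close>

definition toeplitz_cb :: "nat \<Rightarrow> nat \<Rightarrow> nat \<Rightarrow> real vec \<Rightarrow> real vec \<Rightarrow> real mat" where
  "toeplitz_cb N n m c b = toeplitz (N - n) c * toeplitz (N - (n - m)) b"

definition mep_matrix ::
    "nat \<Rightarrow> nat \<Rightarrow> nat \<Rightarrow> real vec \<Rightarrow> real vec \<Rightarrow> real vec \<Rightarrow> real mat" where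
  "mep_matrix N n m c y b =
     (let T = toeplitz_cb N n m c b
      in mat_of_cols (N - n)
           ((T *\<^sub>v y) # cols (T * T\<^sup>T * (toeplitz (N - 2 * n + m) b)\<^sup>T)))"

definition real_affine_eigenvalue ::
    "nat \<Rightarrow> nat \<Rightarrow> nat \<Rightarrow> real vec \<Rightarrow> real vec \<Rightarrow> real vec \<Rightarrow> real vec \<Rightarrow> bool" where
  "real_affine_eigenvalue N n m c y e b \<longleftrightarrow>
     b \<in> carrier_vec (n - m + 1) \<and> b \<bullet> e = 1 \<and>
     vec_space.rank (N - n) (mep_matrix N n m c y b) < N - 2 * n + m + 1"

definition euclid_norm :: "real vec \<Rightarrow> real" where
  "euclid_norm v = sqrt (v \<bullet> v)"

definition objective :: "real vec \<Rightarrow> real vec \<Rightarrow> real" where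
  "objective y yh = 1 / 2 * (euclid_norm (y - yh))\<^sup>2"

definition feasible ::
    "nat \<Rightarrow> nat \<Rightarrow> nat \<Rightarrow> real vec \<Rightarrow> real vec \<Rightarrow> real vec \<Rightarrow> real vec \<Rightarrow> bool" where
  "feasible N n m c e b yh \<longleftrightarrow>
     b \<in> carrier_vec (n - m + 1) \<and> yh \<in> carrier_vec N \<and>
     toeplitz_cb N n m c b *\<^sub>v yh = 0\<^sub>v (N - n) \<and> b \<bullet> e = 1"

definition local_minimizer ::
    "nat \<Rightarrow> nat \<Rightarrow> nat \<Rightarrow> real vec \<Rightarrow> real vec \<Rightarrow> real vec \<Rightarrow> real vec \<Rightarrow> real vec \<Rightarrow> bool" where
  "local_minimizer N n m c y e b yh \<longleftrightarrow>
     feasible N n m c e b yh \<and>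
     (\<exists>\<epsilon>>0. \<forall>b' yh'. feasible N n m c e b' yh' \<longrightarrow>
        euclid_norm (b' - b) < \<epsilon> \<longrightarrow> euclid_norm (yh' - yh) < \<epsilon> \<longrightarrow>
        objective y yh \<le> objective y yh')"

definition lagrangian ::
    "nat \<Rightarrow> nat \<Rightarrow> nat \<Rightarrow> real vec \<Rightarrow> real vec \<Rightarrow> real vec \<Rightarrow>
     real vec \<Rightarrow> real vec \<Rightarrow> real vec \<Rightarrow> real \<Rightarrow> real" where
  "lagrangian N n m c y e b yh lam mu =
     objective y yh + lam \<bullet> (toeplitz_cb N n m c b *\<^sub>v yh) + mu * (b \<bullet> e - 1)"

definition partials_vanish :: "nat \<Rightarrow> (real vec \<Rightarrow> real) \<Rightarrow> real vec \<Rightarrow> bool" where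
  "partials_vanish k f v \<longleftrightarrow>
     (\<forall>i<k. ((\<lambda>t. f (v + t \<cdot>\<^sub>v unit_vec k i)) has_real_derivative 0) (at 0))"

definition critical_point ::
    "nat \<Rightarrow> nat \<Rightarrow> nat \<Rightarrow> real vec \<Rightarrow> real vec \<Rightarrow> real vec \<Rightarrow>
     real vec \<Rightarrow> real vec \<Rightarrow> real vec \<Rightarrow> real \<Rightarrow> bool" where
  "critical_point N n m c y e b yh lam mu \<longleftrightarrow>
     b \<in> carrier_vec (n - m + 1) \<and> yh \<in> carrier_vec N \<and> lam \<in> carrier_vec (N - n) \<and>
     partials_vanish (n - m + 1) (\<lambda>b'. lagrangian N n m c y e b' yh lam mu) b \<and>
     partials_vanish N (\<lambda>yh'. lagrangian N n m c y e b yh' lam mu) yh \<and>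
     partials_vanish (N - n) (\<lambda>lam'. lagrangian N n m c y e b yh lam' mu) lam \<and>
     ((\<lambda>mu'. lagrangian N n m c y e b yh lam mu') has_real_derivative 0) (at mu)"

lemma pole_coeffs_carrier: "pole_coeffs m p \<in> carrier_vec (m + 1)"
  by (simp add: pole_coeffs_def)

lemma toeplitz_carrier:
  assumes "v \<in> carrier_vec (d + 1)"
  shows "toeplitz k v \<in> carrier_mat k (k + d)"
  using assms by (simp add: toeplitz_def)

lemma toeplitz_cb_carrier:
  assumes "m < n" "2 * n < N" "c \<in> carrier_vec (m + 1)" "b \<in> carrier_vec (n - m + 1)"
  shows "toeplitz_cb N n m c b \<in> carrier_mat (N - n) N"
proof -
  have "toeplitz (N - n) c \<in> carrier_mat (N - n) (N - (n - m))"
    using toeplitz_carrier[OF assms(3), of "N - n"] assms(1,2) by (simp add: algebra_simps)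
  moreover have "toeplitz (N - (n - m)) b \<in> carrier_mat (N - (n - m)) N"
    using toeplitz_carrier[OF assms(4), of "N - (n - m)"] assms(1,2) by simp
  ultimately show ?thesis
    unfolding toeplitz_cb_def by (rule mult_carrier_mat)
qed

lemma mep_matrix_carrier:
  assumes "m < n" "2 * n < N" "c \<in> carrier_vec (m + 1)" "b \<in> carrier_vec (n - m + 1)"
  shows "mep_matrix N n m c y b \<in> carrier_mat (N - n) (N - 2 * n + m + 1)"
proof -
  have "dim_row (toeplitz (N - 2 * n + m) b) = N - 2 * n + m"
    by (simp add: toeplitz_def)
  then show ?thesis
    unfolding mep_matrix_def Let_def by (intro carrier_matI) simp_all
qed

lemma rank_deficient_iff:
  fixes A :: "'a :: field mat"
  assumes A: "A \<in> carrier_mat nr nc"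
  shows "vec_space.rank nr A < nc \<longleftrightarrow>
           (\<exists>v \<in> carrier_vec nc. v \<noteq> 0\<^sub>v nc \<and> A *\<^sub>v v = 0\<^sub>v nr)"
proof -
  interpret vec_space "TYPE('a)" nr .
  show ?thesis
  proof (cases "distinct (cols A)")
    case True
    have "rank A < nc \<longleftrightarrow> lin_dep (set (cols A))"
      using full_rank_lin_indpt[OF A _ True] lin_indpt_full_rank[OF A True] rank_le_nc[OF A]
      by linarith
    also have "\<dots> \<longleftrightarrow> (\<exists>v \<in> carrier_vec nc. v \<noteq> 0\<^sub>v nc \<and> A *\<^sub>v v = 0\<^sub>v nr)"
    proof
      assume "lin_dep (set (cols A))"
      from lin_depE[OF A this True]
      obtain v where "v \<in> carrier_vec nc" "v \<noteq> 0\<^sub>v nc" "A *\<^sub>v v = 0\<^sub>v nr" .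
      then show "\<exists>v \<in> carrier_vec nc. v \<noteq> 0\<^sub>v nc \<and> A *\<^sub>v v = 0\<^sub>v nr" by blast
    next
      assume "\<exists>v \<in> carrier_vec nc. v \<noteq> 0\<^sub>v nc \<and> A *\<^sub>v v = 0\<^sub>v nr"
      then obtain v where "v \<in> carrier_vec nc" "v \<noteq> 0\<^sub>v nc" "A *\<^sub>v v = 0\<^sub>v nr" by blast
      then show "lin_dep (set (cols A))" using lin_depI[OF A _ _ _ True] by blast
    qed
    finally show ?thesis .
  next
    case False
    then obtain i j where ij: "i < nc" "j < nc" "i \<noteq> j" "col A i = col A j"
      using A by (auto simp: distinct_conv_nth)
    have "rank A < nc"
    proof -
      obtain S where S: "maximal S (\<lambda>T. T \<subseteq> set (cols A) \<and> lin_indpt T)"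
        using maximal_exists[of "(\<lambda>T. T \<subseteq> set (cols A) \<and> lin_indpt T)" "card (set (cols A))" "{}"]
        by (meson List.finite_set card_mono empty_iff empty_subsetI finite_lin_indpt2 rev_finite_subset)
      then have "card S \<le> card (set (cols A))" by (simp add: card_mono maximal_def)
      moreover have "card (set (cols A)) < length (cols A)"
        using False card_distinct card_length nat_less_le by blast
      ultimately show ?thesis
        using rank_card_indpt[OF A S] A by simp
    qed
    moreover have "\<exists>v \<in> carrier_vec nc. v \<noteq> 0\<^sub>v nc \<and> A *\<^sub>v v = 0\<^sub>v nr"
    proof (intro bexI conjI)
      let ?v = "unit_vec nc i - unit_vec nc j :: 'a vec"
      show "?v \<in> carrier_vec nc" by simp
      have "?v $ i = 1" using ij by simp
      then show "?v \<noteq> 0\<^sub>v nc" using ij(1) by (metis index_zero_vec(1) zero_neq_one)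
      have "A *\<^sub>v ?v = A *\<^sub>v unit_vec nc i - A *\<^sub>v unit_vec nc j"
        using A by (intro mult_minus_distrib_mat_vec) auto
      also have "\<dots> = col A i - col A j"
        using A ij(1,2) by (intro arg_cong2[of _ _ _ _ "(-)"] eq_vecI) auto
      finally show "A *\<^sub>v ?v = 0\<^sub>v nr" using A ij by auto
    qed
    ultimately show ?thesis by blast
  qed
qed

lemma real_kernel_iff_complex_kernel:
  fixes A :: "real mat"
  assumes A: "A \<in> carrier_mat nr nc"
  shows "(\<exists>v \<in> carrier_vec nc. v \<noteq> 0\<^sub>v nc \<and> A *\<^sub>v v = 0\<^sub>v nr) \<longleftrightarrow>
         (\<exists>z \<in> carrier_vec nc. z \<noteq> 0\<^sub>v nc \<and> map_mat complex_of_real A *\<^sub>v z = 0\<^sub>v nr)"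
    (is "?R \<longleftrightarrow> ?C")
proof
  assume ?R
  then obtain v where v: "v \<in> carrier_vec nc" "v \<noteq> 0\<^sub>v nc" "A *\<^sub>v v = 0\<^sub>v nr" by blast
  have "map_mat complex_of_real A *\<^sub>v map_vec complex_of_real v
          = map_vec complex_of_real (A *\<^sub>v v)"
    using A v(1) by (auto simp: scalar_prod_def)
  then have "map_mat complex_of_real A *\<^sub>v map_vec complex_of_real v = 0\<^sub>v nr"
    using v(3) by auto
  moreover have "map_vec complex_of_real v \<noteq> 0\<^sub>v nc"
  proof
    assume "map_vec complex_of_real v = 0\<^sub>v nc"
    then have "v $ i = 0" if "i < nc" for i
      using that v(1) by (metis carrier_vecD index_map_vec(1) index_zero_vec(1) of_real_eq_0_iff)
    then show False using v(1,2) by auto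
  qed
  ultimately show ?C using v(1) by (intro bexI[of _ "map_vec complex_of_real v"]) auto
next
  assume ?C
  then obtain z where z: "z \<in> carrier_vec nc" "z \<noteq> 0\<^sub>v nc"
    "map_mat complex_of_real A *\<^sub>v z = 0\<^sub>v nr" by blast
  have s: "(\<Sum>j<nc. complex_of_real (A $$ (i, j)) * z $ j) = 0" if "i < nr" for i
  proof -
    have "(map_mat complex_of_real A *\<^sub>v z) $ i = 0" using z(3) that by simp
    then show ?thesis
      using A z(1) that by (simp add: scalar_prod_def atLeast0LessThan)
  qed
  have "A *\<^sub>v map_vec Re z = 0\<^sub>v nr"
  proof (rule eq_vecI)
    fix i assume "i < dim_vec (0\<^sub>v nr :: real vec)"
    then have i: "i < nr" by simp
    have "(\<Sum>j<nc. A $$ (i, j) * Re (z $ j)) = Re (\<Sum>j<nc. complex_of_real (A $$ (i, j)) * z $ j)"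
      by simp
    then show "(A *\<^sub>v map_vec Re z) $ i = 0\<^sub>v nr $ i"
      using A z(1) i s[OF i] by (simp add: scalar_prod_def atLeast0LessThan)
  qed (use A in simp)
  moreover have "A *\<^sub>v map_vec Im z = 0\<^sub>v nr"
  proof (rule eq_vecI)
    fix i assume "i < dim_vec (0\<^sub>v nr :: real vec)"
    then have i: "i < nr" by simp
    have "(\<Sum>j<nc. A $$ (i, j) * Im (z $ j)) = Im (\<Sum>j<nc. complex_of_real (A $$ (i, j)) * z $ j)"
      by simp
    then show "(A *\<^sub>v map_vec Im z) $ i = 0\<^sub>v nr $ i"
      using A z(1) i s[OF i] by (simp add: scalar_prod_def atLeast0LessThan)
  qed (use A in simp)
  moreover have "map_vec Re z \<noteq> 0\<^sub>v nc \<or> map_vec Im z \<noteq> 0\<^sub>v nc"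
  proof (rule ccontr)
    assume "\<not> ?thesis"
    then have *: "map_vec Re z = 0\<^sub>v nc" "map_vec Im z = 0\<^sub>v nc" by auto
    have "z $ i = 0" if "i < nc" for i
    proof -
      have "map_vec Re z $ i = 0" "map_vec Im z $ i = 0" using * that by simp_all
      then show ?thesis using that z(1) by (simp add: complex_eq_iff)
    qed
    then show False using z(1,2) by auto
  qed
  moreover have "map_vec Re z \<in> carrier_vec nc" "map_vec Im z \<in> carrier_vec nc"
    using z(1) by auto
  ultimately show ?R by blast
qed

lemma real_affine_eigenvalue_iff:
  assumes "m < n" "2 * n < N" "c \<in> carrier_vec (m + 1)"
  shows "real_affine_eigenvalue N n m c y e b \<longleftrightarrow>
     b \<in> carrier_vec (n - m + 1) \<and> b \<bullet> e = 1 \<and>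
     (\<exists>z \<in> carrier_vec (N - 2 * n + m + 1). z \<noteq> 0\<^sub>v (N - 2 * n + m + 1) \<and>
        map_mat complex_of_real (mep_matrix N n m c y b) *\<^sub>v z = 0\<^sub>v (N - n))"
  using rank_deficient_iff[OF mep_matrix_carrier[OF assms]]
    real_kernel_iff_complex_kernel[OF mep_matrix_carrier[OF assms]]
  unfolding real_affine_eigenvalue_def by blast

lemma toeplitz_mult_eq_hankel_mult:
  assumes b: "b \<in> carrier_vec (q + 1)" and x: "x \<in> carrier_vec (k + q)"
  shows "toeplitz k b *\<^sub>v x = hankel k (q + 1) x *\<^sub>v b"
proof (rule eq_vecI)
  fix i assume "i < dim_vec (hankel k (q + 1) x *\<^sub>v b)"
  then have i: "i < k" by (simp add: hankel_def)
  have "(toeplitz k b *\<^sub>v x) $ i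
      = (\<Sum>j\<in>{0..<k + q}. (if i \<le> j \<and> j < i + (q + 1) then b $ (j - i) else 0) * x $ j)"
    using i b x by (simp add: toeplitz_def scalar_prod_def)
  also have "\<dots> = (\<Sum>j\<in>{i..<i + (q + 1)}. b $ (j - i) * x $ j)"
    using i by (intro sum.mono_neutral_cong_right) auto
  also have "\<dots> = (\<Sum>j\<in>{0..<q + 1}. x $ (i + j) * b $ j)"
    by (rule sum.reindex_bij_witness[of _ "\<lambda>j. i + j" "\<lambda>j. j - i"]) auto
  also have "\<dots> = (hankel k (q + 1) x *\<^sub>v b) $ i"
    using i b by (simp add: hankel_def scalar_prod_def)
  finally show "(toeplitz k b *\<^sub>v x) $ i = (hankel k (q + 1) x *\<^sub>v b) $ i" .
qed (simp add: toeplitz_def hankel_def)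

lemma partials_vanish_iff:
  assumes "g \<in> carrier_vec k"
    and "\<And>i. i < k \<Longrightarrow> ((\<lambda>t. f (v + t \<cdot>\<^sub>v unit_vec k i)) has_real_derivative g $ i) (at 0)"
  shows "partials_vanish k f v \<longleftrightarrow> g = 0\<^sub>v k"
proof
  assume L: "partials_vanish k f v"
  have "g $ i = 0" if "i < k" for i
    using DERIV_unique[OF assms(2)[OF that]] L that unfolding partials_vanish_def by blast
  then show "g = 0\<^sub>v k" using assms(1) by auto
next
  assume "g = 0\<^sub>v k"
  then show "partials_vanish k f v"
    using assms(2) unfolding partials_vanish_def by auto
qed

lemma scalar_prod_partial:
  fixes g v :: "real vec"
  assumes "g \<in> carrier_vec k" "v \<in> carrier_vec k" "i < k"
  shows "g \<bullet> (v + t \<cdot>\<^sub>v unit_vec k i) = g \<bullet> v + t * g $ i"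
  using assms by (simp add: scalar_prod_add_distrib[of _ k])

lemma objective_eq:
  "objective y yh = (y - yh) \<bullet> (y - yh) / 2"
proof -
  have "(y - yh) \<bullet> (y - yh) \<ge> 0" by (simp add: scalar_prod_def sum_nonneg)
  then show ?thesis by (simp add: objective_def euclid_norm_def)
qed

lemma objective_partial:
  assumes "y \<in> carrier_vec k" "yh \<in> carrier_vec k" "i < k"
  shows "objective y (yh + t \<cdot>\<^sub>v unit_vec k i) = objective y yh + t * (yh - y) $ i + t\<^sup>2 / 2"
proof -
  let ?u = "unit_vec k i :: real vec"
  have "y - (yh + t \<cdot>\<^sub>v ?u) = (y - yh) + (- t) \<cdot>\<^sub>v ?u"
    using assms by auto
  moreover have "((y - yh) + (- t) \<cdot>\<^sub>v ?u) \<bullet> ((y - yh) + (- t) \<cdot>\<^sub>v ?u)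
      = ((y - yh) + (- t) \<cdot>\<^sub>v ?u) \<bullet> (y - yh) - t * ((y - yh) + (- t) \<cdot>\<^sub>v ?u) $ i"
    using assms by (subst scalar_prod_partial) auto
  moreover have "((y - yh) + (- t) \<cdot>\<^sub>v ?u) \<bullet> (y - yh) = (y - yh) \<bullet> ((y - yh) + (- t) \<cdot>\<^sub>v ?u)"
    using assms by (intro comm_scalar_prod[of _ k]) auto
  moreover have "\<dots> = (y - yh) \<bullet> (y - yh) - t * (y - yh) $ i"
    using assms by (subst scalar_prod_partial) auto
  ultimately show ?thesis
    using assms by (simp add: objective_eq field_simps power2_eq_square)
qed

lemma scalar_prod_mult_mat_vec:
  fixes A :: "real mat"
  assumes "A \<in> carrier_mat nr nc" "l \<in> carrier_vec nr" "v \<in> carrier_vec nc"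
  shows "l \<bullet> (A *\<^sub>v v) = (A\<^sup>T *\<^sub>v l) \<bullet> v"
  using transpose_vec_mult_scalar[OF assms(1,3,2)] by simp

lemma critical_point_iff:
  assumes mn: "m < n" "2 * n < N" and c: "c \<in> carrier_vec (m + 1)"
    and y: "y \<in> carrier_vec N" and e: "e \<in> carrier_vec (n - m + 1)"
  shows "critical_point N n m c y e b yh lam mu \<longleftrightarrow>
     b \<in> carrier_vec (n - m + 1) \<and> yh \<in> carrier_vec N \<and> lam \<in> carrier_vec (N - n) \<and>
     (hankel (N - (n - m)) (n - m + 1) yh)\<^sup>T *\<^sub>v ((toeplitz (N - n) c)\<^sup>T *\<^sub>v lam) + mu \<cdot>\<^sub>v e
       = 0\<^sub>v (n - m + 1) \<and>
     yh - y + (toeplitz (N - (n - m)) b)\<^sup>T *\<^sub>v ((toeplitz (N - n) c)\<^sup>T *\<^sub>v lam) = 0\<^sub>v N \<and>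
     toeplitz (N - n) c *\<^sub>v (toeplitz (N - (n - m)) b *\<^sub>v yh) = 0\<^sub>v (N - n) \<and>
     b \<bullet> e = 1"
proof (cases "b \<in> carrier_vec (n - m + 1) \<and> yh \<in> carrier_vec N \<and> lam \<in> carrier_vec (N - n)")
  case False
  then show ?thesis unfolding critical_point_def by blast
next
  case True
  then have b: "b \<in> carrier_vec (n - m + 1)" and yh: "yh \<in> carrier_vec N"
    and lam: "lam \<in> carrier_vec (N - n)" by auto
  define q where "q = n - m"
  define Tc where "Tc = toeplitz (N - n) c"
  define Tb where "Tb = toeplitz (N - q) b"
  define H where "H = hankel (N - q) (q + 1) yh"
  have Nq: "N - n + m = N - q" "N - q + q = N" using mn by (auto simp: q_def)
  have Tc: "Tc \<in> carrier_mat (N - n) (N - q)"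
    using toeplitz_carrier[OF c, of "N - n"] by (simp add: Tc_def Nq)
  have Tb': "toeplitz (N - q) b' \<in> carrier_mat (N - q) N" if "b' \<in> carrier_vec (q + 1)" for b'
    using toeplitz_carrier[OF that, of "N - q"] Nq by simp
  have Tb: "Tb \<in> carrier_mat (N - q) N" using Tb' b by (simp add: Tb_def q_def)
  have H: "H \<in> carrier_mat (N - q) (q + 1)" by (simp add: H_def hankel_def)
  have b: "b \<in> carrier_vec (q + 1)" and e: "e \<in> carrier_vec (q + 1)"
    using b e by (simp_all add: q_def)
  have cb: "toeplitz_cb N n m c b' *\<^sub>v x = Tc *\<^sub>v (toeplitz (N - q) b' *\<^sub>v x)"
    if "b' \<in> carrier_vec (q + 1)" "x \<in> carrier_vec N" for b' x
    unfolding toeplitz_cb_def q_def[symmetric] Tc_def[symmetric]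
    using Tc Tb'[OF that(1)] that(2) by (rule assoc_mult_mat_vec)
  have Hb: "toeplitz (N - q) b' *\<^sub>v yh = H *\<^sub>v b'" if "b' \<in> carrier_vec (q + 1)" for b'
    unfolding H_def using toeplitz_mult_eq_hankel_mult[OF that, of yh "N - q"] yh Nq by simp
  define w where "w = Tc\<^sup>T *\<^sub>v lam"
  have w: "w \<in> carrier_vec (N - q)" using Tc lam by (simp add: w_def)

  have unitc: "v + t \<cdot>\<^sub>v unit_vec k i \<in> carrier_vec k" if "v \<in> carrier_vec k"
    for v :: "real vec" and t k i using that by simp

  define g1 where "g1 = H\<^sup>T *\<^sub>v w + mu \<cdot>\<^sub>v e"
  have g1: "g1 \<in> carrier_vec (q + 1)" using H w e by (simp add: g1_def)
  have L1: "lagrangian N n m c y e b' yh lam mu = objective y yh - mu + g1 \<bullet> b'"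
    if b': "b' \<in> carrier_vec (q + 1)" for b'
  proof -
    have "lam \<bullet> (Tc *\<^sub>v (H *\<^sub>v b')) = w \<bullet> (H *\<^sub>v b')"
      unfolding w_def using Tc H lam b' by (intro scalar_prod_mult_mat_vec) auto
    also have "\<dots> = (H\<^sup>T *\<^sub>v w) \<bullet> b'"
      using H w b' by (rule scalar_prod_mult_mat_vec)
    finally have "lam \<bullet> (toeplitz_cb N n m c b' *\<^sub>v yh) = (H\<^sup>T *\<^sub>v w) \<bullet> b'"
      by (simp add: cb[OF b' yh] Hb[OF b'])
    moreover have "g1 \<bullet> b' = (H\<^sup>T *\<^sub>v w) \<bullet> b' + mu * (e \<bullet> b')"
      unfolding g1_def using H w e b' by (subst add_scalar_prod_distrib[of _ "q + 1"]) auto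
    moreover have "e \<bullet> b' = b' \<bullet> e" using e b' by (rule comm_scalar_prod)
    ultimately show ?thesis by (simp add: lagrangian_def algebra_simps)
  qed
  have P1: "partials_vanish (q + 1) (\<lambda>b'. lagrangian N n m c y e b' yh lam mu) b
              \<longleftrightarrow> g1 = 0\<^sub>v (q + 1)"
  proof (rule partials_vanish_iff[OF g1])
    fix i assume i: "i < q + 1"
    have "(\<lambda>t. lagrangian N n m c y e (b + t \<cdot>\<^sub>v unit_vec (q + 1) i) yh lam mu)
        = (\<lambda>t. objective y yh - mu + (g1 \<bullet> b + t * g1 $ i))"
      using L1[OF unitc[OF b]] scalar_prod_partial[OF g1 b i] by auto
    then show "((\<lambda>t. lagrangian N n m c y e (b + t \<cdot>\<^sub>v unit_vec (q + 1) i) yh lam mu)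
        has_real_derivative g1 $ i) (at 0)"
      by (auto intro!: derivative_eq_intros)
  qed

  define h where "h = Tb\<^sup>T *\<^sub>v w"
  have h: "h \<in> carrier_vec N" using Tb w by (simp add: h_def)
  have L2: "lagrangian N n m c y e b x lam mu = objective y x + h \<bullet> x + mu * (b \<bullet> e - 1)"
    if x: "x \<in> carrier_vec N" for x
  proof -
    have "lam \<bullet> (Tc *\<^sub>v (Tb *\<^sub>v x)) = w \<bullet> (Tb *\<^sub>v x)"
      unfolding w_def using Tc Tb lam x by (intro scalar_prod_mult_mat_vec) auto
    also have "\<dots> = h \<bullet> x"
      unfolding h_def using Tb w x by (rule scalar_prod_mult_mat_vec)
    finally show ?thesis by (simp add: lagrangian_def cb[OF b x] Tb_def)
  qed
  have P2: "partials_vanish N (\<lambda>yh'. lagrangian N n m c y e b yh' lam mu) yh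
              \<longleftrightarrow> yh - y + h = 0\<^sub>v N"
  proof (rule partials_vanish_iff)
    show "yh - y + h \<in> carrier_vec N" using yh y h by simp
    fix i assume i: "i < N"
    have "(\<lambda>t. lagrangian N n m c y e b (yh + t \<cdot>\<^sub>v unit_vec N i) lam mu)
        = (\<lambda>t. (objective y yh + t * (yh - y) $ i + t\<^sup>2 / 2) + (h \<bullet> yh + t * h $ i)
                + mu * (b \<bullet> e - 1))"
      using L2[OF unitc[OF yh]] scalar_prod_partial[OF h yh i] objective_partial[OF y yh i] by auto
    moreover have "(yh - y + h) $ i = (yh - y) $ i + h $ i" using i h by simp
    ultimately show "((\<lambda>t. lagrangian N n m c y e b (yh + t \<cdot>\<^sub>v unit_vec N i) lam mu)
        has_real_derivative (yh - y + h) $ i) (at 0)"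
      by (auto intro!: derivative_eq_intros)
  qed

  define r where "r = Tc *\<^sub>v (Tb *\<^sub>v yh)"
  have r: "r \<in> carrier_vec (N - n)" unfolding r_def using Tc Tb yh by (meson mult_mat_vec_carrier)
  have L3: "lagrangian N n m c y e b yh l mu' = objective y yh + r \<bullet> l + mu' * (b \<bullet> e - 1)"
    if "l \<in> carrier_vec (N - n)" for l mu'
    using comm_scalar_prod[OF r that] by (simp add: lagrangian_def cb[OF b yh] r_def Tb_def)
  have P3: "partials_vanish (N - n) (\<lambda>lam'. lagrangian N n m c y e b yh lam' mu) lam
              \<longleftrightarrow> r = 0\<^sub>v (N - n)"
  proof (rule partials_vanish_iff[OF r])
    fix i assume i: "i < N - n"
    have "(\<lambda>t. lagrangian N n m c y e b yh (lam + t \<cdot>\<^sub>v unit_vec (N - n) i) mu)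
        = (\<lambda>t. objective y yh + (r \<bullet> lam + t * r $ i) + mu * (b \<bullet> e - 1))"
      using L3[OF unitc[OF lam]] scalar_prod_partial[OF r lam i] by auto
    then show "((\<lambda>t. lagrangian N n m c y e b yh (lam + t \<cdot>\<^sub>v unit_vec (N - n) i) mu)
        has_real_derivative r $ i) (at 0)"
      by (auto intro!: derivative_eq_intros)
  qed

  have "((\<lambda>mu'. lagrangian N n m c y e b yh lam mu') has_real_derivative b \<bullet> e - 1) (at mu)"
    unfolding L3[OF lam] by (auto intro!: derivative_eq_intros)
  then have P4: "((\<lambda>mu'. lagrangian N n m c y e b yh lam mu') has_real_derivative 0) (at mu)
              \<longleftrightarrow> b \<bullet> e = 1"
    by (metis DERIV_unique eq_iff_diff_eq_0)

  show ?thesis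
    unfolding critical_point_def q_def[symmetric] P1 P2 P3 P4
    unfolding g1_def h_def r_def w_def H_def Tb_def Tc_def
    using True by (simp add: q_def)
qed

end

theory Submission
  imports Defs
    "HOL-Computational_Algebra.Field_as_Ring"
    "HOL-Computational_Algebra.Polynomial_Factorial"
begin

text \<open>
  Write \<open>T = T\<^sup>c\<^sup>b\<close>; as polynomials multiply without zero divisors, \<open>T\<^sup>T\<close> is injective for \<open>b \<noteq> 0\<close>.
  Hence \<open>b\<close> is an eigenvalue iff \<open>T y = T T\<^sup>T \<lambda>\<close> for some \<open>\<lambda>\<close> in the range of \<open>(T\<^sup>b)\<^sup>T\<close>. For such a \<open>\<lambda>\<close>
  the vector \<open>x = y - T\<^sup>T \<lambda>\<close> is feasible. With \<open>G = T\<^sup>c X\<close>, where \<open>X\<close> is the Hankel matrix of \<open>x\<close>,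
  commutation of Toeplitz matrices gives \<open>T\<^sup>b G = 0\<close>, hence \<open>G\<^sup>T \<lambda> = 0\<close>, and \<open>x\<close> is critical with \<open>\<mu> = 0\<close>.

  Conversely, a local minimizer \<open>(b, x)\<close> satisfies \<open>y - x = T\<^sup>T \<lambda>\<close> and \<open>G\<^sup>T \<lambda> = 0\<close>. If the kernel of
  \<open>G\<close> is the line of \<open>b\<close>, a dimension count puts \<open>\<lambda>\<close> into the range of \<open>(T\<^sup>b)\<^sup>T\<close>. Otherwise there is
  \<open>d \<noteq> 0\<close> orthogonal to \<open>e\<close> such that all \<open>(b + t d, x)\<close> are feasible; for small \<open>t\<close> they are local
  minimizers, too, so the polynomial of \<open>y - x\<close> is divisible by infinitely many pairwise
  non-associated polynomials \<open>b + t d\<close>. This forces \<open>x = y\<close>, and then \<open>T y = 0\<close>.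
\<close>

subsection \<open>Real matrices\<close>

lemma scalar_prod_self_eq_0_iff:
  fixes v :: "real vec"
  assumes "v \<in> carrier_vec n"
  shows "v \<bullet> v = 0 \<longleftrightarrow> v = 0\<^sub>v n"
proof
  assume "v \<bullet> v = 0"
  then have "\<forall>i\<in>{0..<dim_vec v}. v $ i * v $ i = 0"
    unfolding scalar_prod_def by (subst (asm) sum_nonneg_eq_0_iff) auto
  then show "v = 0\<^sub>v n" using assms by auto
qed simp

text \<open>By adjointness \<open>(A x) \<bullet> (A x) = (A\<^sup>T A x) \<bullet> x\<close>, so
  the vector \<open>A x\<close> is orthogonal to itself.\<close>

lemma transpose_mult_mat_vec_eq_0:
  fixes A :: "real mat"
  assumes A: "A \<in> carrier_mat nr nc" and x: "x \<in> carrier_vec nc"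
    and 0: "A\<^sup>T *\<^sub>v (A *\<^sub>v x) = 0\<^sub>v nc"
  shows "A *\<^sub>v x = 0\<^sub>v nr"
proof -
  have Ax: "A *\<^sub>v x \<in> carrier_vec nr" using A x by simp
  have "(A *\<^sub>v x) \<bullet> (A *\<^sub>v x) = (A\<^sup>T *\<^sub>v (A *\<^sub>v x)) \<bullet> x"
    using scalar_prod_mult_mat_vec[OF A Ax x] .
  also have "\<dots> = 0" using 0 x by simp
  finally show ?thesis using scalar_prod_self_eq_0_iff[OF Ax] by simp
qed

text \<open>Cramer's rule in explicit form: the solution is a rational expression in the entries of
  \<open>A\<close>, which later yields its continuity in a parameter.\<close>

lemma adj_mat_solves:
  fixes A :: "'a :: field mat"
  assumes A: "A \<in> carrier_mat n n" and r: "r \<in> carrier_vec n" and "det A \<noteq> 0"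
  shows "A *\<^sub>v ((1 / det A) \<cdot>\<^sub>v (adj_mat A *\<^sub>v r)) = r"
proof -
  have "A *\<^sub>v (adj_mat A *\<^sub>v r) = (A * adj_mat A) *\<^sub>v r"
    using assoc_mult_mat_vec[OF A adj_mat(1)[OF A] r] by simp
  also have "\<dots> = det A \<cdot>\<^sub>v r"
    using adj_mat(2)[OF A] r by (auto intro!: eq_vecI simp: scalar_prod_def if_distrib[where f = "\<lambda>x. x * a" for a]
        if_distrib[where f = "\<lambda>x. a * x" for a] cong: if_cong)
  finally have "A *\<^sub>v (adj_mat A *\<^sub>v r) = det A \<cdot>\<^sub>v r" .
  then show ?thesis
    using assms mult_mat_vec[OF A, of "adj_mat A *\<^sub>v r" "1 / det A"] adj_mat[OF A]
    by (simp add: smult_smult_assoc)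
qed

lemma injective_square_mat_solvable:
  fixes A :: "'a :: field mat"
  assumes A: "A \<in> carrier_mat n n" and r: "r \<in> carrier_vec n"
    and inj: "\<And>x. x \<in> carrier_vec n \<Longrightarrow> A *\<^sub>v x = 0\<^sub>v n \<Longrightarrow> x = 0\<^sub>v n"
  obtains x where "x \<in> carrier_vec n" "A *\<^sub>v x = r"
proof
  have "det A \<noteq> 0" using det_0_iff_vec_prod_zero[OF A] inj by blast
  then show "A *\<^sub>v ((1 / det A) \<cdot>\<^sub>v (adj_mat A *\<^sub>v r)) = r"
    by (rule adj_mat_solves[OF A r])
  show "(1 / det A) \<cdot>\<^sub>v (adj_mat A *\<^sub>v r) \<in> carrier_vec n"
    using adj_mat(1)[OF A] r by (metis mult_mat_vec_carrier smult_carrier_vec)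
qed

lemma gram_injective:
  fixes A :: "real mat"
  assumes A: "A \<in> carrier_mat nr nc"
    and inj: "\<And>l. l \<in> carrier_vec nr \<Longrightarrow> A\<^sup>T *\<^sub>v l = 0\<^sub>v nc \<Longrightarrow> l = 0\<^sub>v nr"
    and l: "l \<in> carrier_vec nr" and 0: "(A * A\<^sup>T) *\<^sub>v l = 0\<^sub>v nr"
  shows "l = 0\<^sub>v nr"
proof (rule inj[OF l])
  have AT: "A\<^sup>T \<in> carrier_mat nc nr" using A by simp
  have "A\<^sup>T\<^sup>T *\<^sub>v (A\<^sup>T *\<^sub>v l) = 0\<^sub>v nr" using A l 0 by simp
  then show "A\<^sup>T *\<^sub>v l = 0\<^sub>v nc" by (rule transpose_mult_mat_vec_eq_0[OF AT l])
qed

text \<open>The difference of \<open>p\<close> and its projection onto the range of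
  \<open>A\<^sup>T\<close> lies in the kernel of \<open>A\<close>. It is orthogonal to
  \<open>p\<close> by \<open>orth\<close> and to that range by adjointness, hence to itself.\<close>

lemma orthogonal_kernel_imp_range_transpose:
  fixes A :: "real mat"
  assumes A: "A \<in> carrier_mat nr nc"
    and inj: "\<And>l. l \<in> carrier_vec nr \<Longrightarrow> A\<^sup>T *\<^sub>v l = 0\<^sub>v nc \<Longrightarrow> l = 0\<^sub>v nr"
    and p: "p \<in> carrier_vec nc"
    and orth: "\<And>v. v \<in> carrier_vec nc \<Longrightarrow> A *\<^sub>v v = 0\<^sub>v nr \<Longrightarrow> p \<bullet> v = 0"
  obtains l where "l \<in> carrier_vec nr" "p = A\<^sup>T *\<^sub>v l"
proof -
  have Ap: "A *\<^sub>v p \<in> carrier_vec nr" using A p by simp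
  \<comment> \<open>These are the normal equations for the projection \<open>A\<^sup>T l\<close>;
    injectivity of the Gram matrix makes them solvable.\<close>
  obtain l where l: "l \<in> carrier_vec nr" "(A * A\<^sup>T) *\<^sub>v l = A *\<^sub>v p"
    using injective_square_mat_solvable[OF _ Ap, of "A * A\<^sup>T"] gram_injective[OF A inj] A
    by (metis mult_carrier_mat transpose_carrier_mat)
  define r where "r = p - A\<^sup>T *\<^sub>v l"
  have r: "r \<in> carrier_vec nc" using A p l by (simp add: r_def)
  have "A *\<^sub>v r = A *\<^sub>v p - A *\<^sub>v (A\<^sup>T *\<^sub>v l)"
    unfolding r_def using A p l by (intro mult_minus_distrib_mat_vec) auto
  also have "\<dots> = 0\<^sub>v nr" using A l Ap by (simp flip: l(2))
  finally have Ar: "A *\<^sub>v r = 0\<^sub>v nr" .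
  have "r \<bullet> r = p \<bullet> r - (A\<^sup>T *\<^sub>v l) \<bullet> r"
    using A p l r unfolding r_def by (intro minus_scalar_prod_distrib[of _ nc]) auto
  also have "(A\<^sup>T *\<^sub>v l) \<bullet> r = l \<bullet> (A *\<^sub>v r)"
    using scalar_prod_mult_mat_vec[OF A l(1) r] by simp
  finally have "r \<bullet> r = 0" using orth[OF r Ar] l Ar by simp
  then have "r = 0\<^sub>v nc" using scalar_prod_self_eq_0_iff[OF r] by simp
  then have "p = A\<^sup>T *\<^sub>v l"
    using p A l unfolding r_def by (intro eq_vecI) (auto simp: vec_eq_iff)
  then show thesis using that l(1) by blast
qed

section \<open>Continuity of determinants, adjugates and products\<close>

lemma tendsto_det:
  fixes M :: "'b \<Rightarrow> 'a :: {real_normed_field} mat"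
  assumes M: "\<And>t. M t \<in> carrier_mat n n" and L: "L \<in> carrier_mat n n"
    and lim: "\<And>i j. i < n \<Longrightarrow> j < n \<Longrightarrow> ((\<lambda>t. M t $$ (i, j)) \<longlongrightarrow> L $$ (i, j)) F"
  shows "((\<lambda>t. det (M t)) \<longlongrightarrow> det L) F"
  unfolding det_def'[OF M] det_def'[OF L]
proof (intro tendsto_sum tendsto_mult tendsto_const tendsto_prod)
  fix p i assume "p \<in> {p. p permutes {0..<n}}" "i \<in> {0..<n}"
  then have "i < n" "p i < n" using permutes_in_image[of p "{0..<n}" i] by auto
  then show "((\<lambda>t. M t $$ (i, p i)) \<longlongrightarrow> L $$ (i, p i)) F" by (rule lim)
qed

lemma tendsto_adj_mat:
  fixes M :: "'b \<Rightarrow> 'a :: {real_normed_field} mat"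
  assumes M: "\<And>t. M t \<in> carrier_mat n n" and L: "L \<in> carrier_mat n n"
    and lim: "\<And>i j. i < n \<Longrightarrow> j < n \<Longrightarrow> ((\<lambda>t. M t $$ (i, j)) \<longlongrightarrow> L $$ (i, j)) F"
    and ij: "i < n" "j < n"
  shows "((\<lambda>t. adj_mat (M t) $$ (i, j)) \<longlongrightarrow> adj_mat L $$ (i, j)) F"
proof -
  have [simp]: "dim_row (M t) = n" "dim_col (M t) = n" for t using M[of t] by auto
  have "((\<lambda>t. det (mat_delete (M t) j i)) \<longlongrightarrow> det (mat_delete L j i)) F"
  proof (rule tendsto_det)
    fix i' j' assume "i' < n - 1" "j' < n - 1"
    then show "((\<lambda>t. mat_delete (M t) j i $$ (i', j')) \<longlongrightarrow> mat_delete L j i $$ (i', j')) F"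
      using L unfolding mat_delete_def by (auto intro!: lim)
  qed (use M L mat_delete_carrier in blast)+
  then show ?thesis
    using L ij unfolding adj_mat_def cofactor_def by (auto intro!: tendsto_intros)
qed

lemma tendsto_mult_mat_vec:
  fixes M :: "'b \<Rightarrow> 'a :: {real_normed_field} mat"
  assumes M: "\<And>t. M t \<in> carrier_mat nr nc" and L: "L \<in> carrier_mat nr nc"
    and lim: "\<And>i j. i < nr \<Longrightarrow> j < nc \<Longrightarrow> ((\<lambda>t. M t $$ (i, j)) \<longlongrightarrow> L $$ (i, j)) F"
    and x: "\<And>t. x t \<in> carrier_vec nc" and y: "y \<in> carrier_vec nc"
    and limx: "\<And>j. j < nc \<Longrightarrow> ((\<lambda>t. x t $ j) \<longlongrightarrow> y $ j) F"
    and i: "i < nr"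
  shows "((\<lambda>t. (M t *\<^sub>v x t) $ i) \<longlongrightarrow> (L *\<^sub>v y) $ i) F"
proof -
  have eq: "(K *\<^sub>v z) $ i = (\<Sum>j<nc. K $$ (i, j) * z $ j)"
    if "K \<in> carrier_mat nr nc" "z \<in> carrier_vec nc" for K and z :: "'a vec"
    using that i by (auto simp: scalar_prod_def atLeast0LessThan)
  show ?thesis
    unfolding eq[OF M x] eq[OF L y]
    using i by (intro tendsto_sum tendsto_mult lim limx) auto
qed

lemma tendsto_scalar_prod:
  fixes x y :: "'b \<Rightarrow> 'a :: {real_normed_field} vec"
  assumes "\<And>t. x t \<in> carrier_vec n" "a \<in> carrier_vec n"
    and "\<And>t. y t \<in> carrier_vec n" "b \<in> carrier_vec n"
    and "\<And>j. j < n \<Longrightarrow> ((\<lambda>t. x t $ j) \<longlongrightarrow> a $ j) F"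
    and "\<And>j. j < n \<Longrightarrow> ((\<lambda>t. y t $ j) \<longlongrightarrow> b $ j) F"
  shows "((\<lambda>t. x t \<bullet> y t) \<longlongrightarrow> a \<bullet> b) F"
proof -
  have [simp]: "dim_vec (y t) = n" for t using assms(3)[of t] by simp
  show ?thesis
    using assms unfolding scalar_prod_def by (auto intro!: tendsto_sum tendsto_mult)
qed

text \<open>
  An implicit function theorem for kernels of a linear matrix pencil: the tangent direction \<open>v\<close> is
  corrected within the range of \<open>A\<^sup>T\<close>, the correction being given by Cramer's rule.
\<close>

lemma pencil_kernel_curve:
  fixes A D :: "real mat"
  assumes A: "A \<in> carrier_mat nr nc" and D: "D \<in> carrier_mat nr nc"
    and inj: "\<And>l. l \<in> carrier_vec nr \<Longrightarrow> A\<^sup>T *\<^sub>v l = 0\<^sub>v nc \<Longrightarrow> l = 0\<^sub>v nr"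
    and x: "x \<in> carrier_vec nc" and v: "v \<in> carrier_vec nc"
    and Ax: "A *\<^sub>v x = 0\<^sub>v nr" and tan: "D *\<^sub>v x + A *\<^sub>v v = 0\<^sub>v nr"
  obtains u where "\<And>t. u t \<in> carrier_vec nc"
    and "\<And>j. j < nc \<Longrightarrow> ((\<lambda>t. u t $ j) \<longlongrightarrow> v $ j) (at 0)"
    and "eventually (\<lambda>t. (A + t \<cdot>\<^sub>m D) *\<^sub>v (x + t \<cdot>\<^sub>v u t) = 0\<^sub>v nr) (at 0)"
proof -
  \<comment> \<open>With \<open>B = A + t D\<close>, the curve needs \<open>B u = A v\<close>,
    because then \<open>B (x + t u) = A x + t (D x + A v) = 0\<close>. Since
    \<open>B v = A v + t D v\<close>, it suffices to subtract \<open>t A\<^sup>T w\<close> from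
    \<open>v\<close>, where \<open>B A\<^sup>T w = D v\<close>.\<close>
  define M where "M t = (A + t \<cdot>\<^sub>m D) * A\<^sup>T" for t
  define r where "r = D *\<^sub>v v"
  define w where "w t = (1 / det (M t)) \<cdot>\<^sub>v (adj_mat (M t) *\<^sub>v r)" for t
  define u where "u t = v + (- t) \<cdot>\<^sub>v (A\<^sup>T *\<^sub>v w t)" for t
  have M: "M t \<in> carrier_mat nr nr" for t
    unfolding M_def using A D by (intro mult_carrier_mat[of _ _ nc]) auto
  have r: "r \<in> carrier_vec nr" using D v by (simp add: r_def)
  have w0: "adj_mat (M t) *\<^sub>v r \<in> carrier_vec nr" for t
    using adj_mat(1)[OF M] r by (metis mult_mat_vec_carrier)
  have w: "w t \<in> carrier_vec nr" for t using w0 by (simp add: w_def)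
  have ATw: "A\<^sup>T *\<^sub>v w t \<in> carrier_vec nc" for t
    using A w by (metis mult_mat_vec_carrier transpose_carrier_mat)
  have u: "u t \<in> carrier_vec nc" for t using v ATw by (simp add: u_def)
  have limM: "((\<lambda>t. M t $$ (i, j)) \<longlongrightarrow> M 0 $$ (i, j)) (at 0)" if "i < nr" "j < nr" for i j
  proof -
    have "M t $$ (i, j) = (\<Sum>k<nc. (A $$ (i, k) + t * D $$ (i, k)) * A $$ (j, k))" for t
      using that A D unfolding M_def by (auto simp: scalar_prod_def atLeast0LessThan)
    then show ?thesis by (auto intro!: tendsto_eq_intros)
  qed
  \<comment> \<open>At 0 the system is a Gram matrix, hence invertible; by continuity of the
    determinant it stays invertible for small \<open>t\<close>.\<close>
  have "M 0 = A * A\<^sup>T" unfolding M_def using A D by (intro arg_cong2[of _ _ _ _ "(*)"]) auto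
  then have det0: "det (M 0) \<noteq> 0"
    using det_0_iff_vec_prod_zero[OF M] gram_injective[OF A inj] by metis
  have limdet: "((\<lambda>t. det (M t)) \<longlongrightarrow> det (M 0)) (at 0)"
    by (rule tendsto_det[OF M M limM])
  have limw: "((\<lambda>t. w t $ j) \<longlongrightarrow> w 0 $ j) (at 0)" if j: "j < nr" for j
  proof -
    have "((\<lambda>t. (adj_mat (M t) *\<^sub>v r) $ j) \<longlongrightarrow> (adj_mat (M 0) *\<^sub>v r) $ j) (at 0)"
      using adj_mat(1)[OF M] r j
      by (intro tendsto_mult_mat_vec[of _ nr nr] tendsto_adj_mat[OF M M limM]) auto
    then have "((\<lambda>t. 1 / det (M t) * (adj_mat (M t) *\<^sub>v r) $ j)
        \<longlongrightarrow> 1 / det (M 0) * (adj_mat (M 0) *\<^sub>v r) $ j) (at 0)"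
      using det0 by (intro tendsto_intros limdet) auto
    moreover have "dim_vec (adj_mat (M t) *\<^sub>v r) = nr" for t by (rule carrier_vecD[OF w0])
    ultimately show ?thesis using j unfolding w_def by (auto simp del: index_mult_mat_vec dim_mult_mat_vec)
  qed
  show thesis
  proof
    show "u t \<in> carrier_vec nc" for t by (rule u)
    show "((\<lambda>t. u t $ j) \<longlongrightarrow> v $ j) (at 0)" if j: "j < nc" for j
    proof -
      have "((\<lambda>t. (A\<^sup>T *\<^sub>v w t) $ j) \<longlongrightarrow> (A\<^sup>T *\<^sub>v w 0) $ j) (at 0)"
        using A w j limw by (intro tendsto_mult_mat_vec[of _ nc nr]) auto
      then have "((\<lambda>t. v $ j + (- t) * (A\<^sup>T *\<^sub>v w t) $ j) \<longlongrightarrow> v $ j + (- 0) * (A\<^sup>T *\<^sub>v w 0) $ j) (at 0)"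
        by (intro tendsto_intros)
      moreover have "u t $ j = v $ j + (- t) * (A\<^sup>T *\<^sub>v w t) $ j" for t
        using j v ATw[of t] unfolding u_def by (simp del: index_mult_mat_vec dim_mult_mat_vec)
      ultimately show ?thesis by (simp del: index_mult_mat_vec)
    qed
    have "eventually (\<lambda>t. det (M t) \<noteq> 0) (at 0)"
      using limdet det0 by (rule tendsto_imp_eventually_ne)
    then show "eventually (\<lambda>t. (A + t \<cdot>\<^sub>m D) *\<^sub>v (x + t \<cdot>\<^sub>v u t) = 0\<^sub>v nr) (at 0)"
    proof eventually_elim
      case (elim t)
      let ?B = "A + t \<cdot>\<^sub>m D"
      have B: "?B \<in> carrier_mat nr nc" using A D by auto
      have BATw: "?B *\<^sub>v (A\<^sup>T *\<^sub>v w t) = r"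
        using adj_mat_solves[OF M r elim] A B w by (simp add: M_def w_def)
      have Bz: "?B *\<^sub>v z = A *\<^sub>v z + t \<cdot>\<^sub>v (D *\<^sub>v z)" if "z \<in> carrier_vec nc" for z
        using A D that by (subst add_mult_distrib_mat_vec[of _ nr nc]) (auto intro!: eq_vecI)
      have Bu: "?B *\<^sub>v u t = A *\<^sub>v v + t \<cdot>\<^sub>v r + (- t) \<cdot>\<^sub>v r"
      proof -
        have "?B *\<^sub>v u t = ?B *\<^sub>v v + ?B *\<^sub>v ((- t) \<cdot>\<^sub>v (A\<^sup>T *\<^sub>v w t))"
          unfolding u_def using B v ATw by (intro mult_add_distrib_mat_vec) auto
        also have "?B *\<^sub>v ((- t) \<cdot>\<^sub>v (A\<^sup>T *\<^sub>v w t)) = (- t) \<cdot>\<^sub>v r"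
          using mult_mat_vec[OF B ATw] BATw by simp
        finally show ?thesis using Bz[OF v] by (simp add: r_def)
      qed
      have "?B *\<^sub>v (x + t \<cdot>\<^sub>v u t) = ?B *\<^sub>v x + t \<cdot>\<^sub>v (?B *\<^sub>v u t)"
        using mult_add_distrib_mat_vec[OF B x, of "t \<cdot>\<^sub>v u t"] mult_mat_vec[OF B u] u by simp
      also have "\<dots> = A *\<^sub>v x + t \<cdot>\<^sub>v (D *\<^sub>v x + A *\<^sub>v v)"
      proof (rule eq_vecI)
        fix i assume "i < dim_vec (A *\<^sub>v x + t \<cdot>\<^sub>v (D *\<^sub>v x + A *\<^sub>v v))"
        then have i: "i < nr" using A D by simp
        have "dim_vec (A *\<^sub>v x) = nr" "dim_vec (D *\<^sub>v x) = nr" "dim_vec (A *\<^sub>v v) = nr" "dim_vec r = nr"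
          using A D r by auto
        then show "(?B *\<^sub>v x + t \<cdot>\<^sub>v (?B *\<^sub>v u t)) $ i = (A *\<^sub>v x + t \<cdot>\<^sub>v (D *\<^sub>v x + A *\<^sub>v v)) $ i"
          unfolding Bu Bz[OF x] using i
          by (simp del: index_mult_mat_vec dim_mult_mat_vec add: algebra_simps)
      qed (use A D in simp)
      finally show ?case using Ax tan by auto
    qed
  qed
qed

section \<open>Orthogonality and left kernels\<close>

lemma eq_0_if_orthogonal:
  fixes x :: "real vec"
  assumes "x \<in> carrier_vec n" "\<And>g. g \<in> carrier_vec n \<Longrightarrow> x \<bullet> g = 0"
  shows "x = 0\<^sub>v n"
  using assms(2)[OF assms(1)] scalar_prod_self_eq_0_iff[OF assms(1)] by simp

text \<open>This is \<open>A G = 0\<close> transposed, with both sides tested against all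
  vectors.\<close>

lemma transpose_mult_eq_0:
  fixes A G :: "real mat"
  assumes A: "A \<in> carrier_mat nr nc" and G: "G \<in> carrier_mat nc p"
    and AG: "\<And>g. g \<in> carrier_vec p \<Longrightarrow> A *\<^sub>v (G *\<^sub>v g) = 0\<^sub>v nr" and w: "w \<in> carrier_vec nr"
  shows "G\<^sup>T *\<^sub>v (A\<^sup>T *\<^sub>v w) = 0\<^sub>v p"
proof (rule eq_0_if_orthogonal)
  have Aw: "A\<^sup>T *\<^sub>v w \<in> carrier_vec nc" using A w by simp
  show "G\<^sup>T *\<^sub>v (A\<^sup>T *\<^sub>v w) \<in> carrier_vec p" using G Aw by simp
  fix g :: "real vec" assume g: "g \<in> carrier_vec p"
  have "(G\<^sup>T *\<^sub>v (A\<^sup>T *\<^sub>v w)) \<bullet> g = (A\<^sup>T *\<^sub>v w) \<bullet> (G *\<^sub>v g)"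
    using scalar_prod_mult_mat_vec[OF G Aw g] by simp
  also have "\<dots> = w \<bullet> (A *\<^sub>v (G *\<^sub>v g))"
    using scalar_prod_mult_mat_vec[OF A w, of "G *\<^sub>v g"] G g by simp
  finally show "(G\<^sup>T *\<^sub>v (A\<^sup>T *\<^sub>v w)) \<bullet> g = 0" using AG[OF g] w by simp
qed

text \<open>
  If \<open>A\<close> has full row rank and annihilates the columns of \<open>G\<close>, and the kernel of \<open>G\<close> is the line
  spanned by \<open>b\<close>, then a count of dimensions (the bordered matrix below is square) shows that the
  left kernel of \<open>G\<close> is the row space of \<open>A\<close>.
\<close>

lemma left_kernel_imp_range_transpose:
  fixes A G :: "real mat"
  assumes A: "A \<in> carrier_mat k (k + q)" and G: "G \<in> carrier_mat (k + q) (q + 1)"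
    and inj: "\<And>w. w \<in> carrier_vec k \<Longrightarrow> A\<^sup>T *\<^sub>v w = 0\<^sub>v (k + q) \<Longrightarrow> w = 0\<^sub>v k"
    and AG: "\<And>g. g \<in> carrier_vec (q + 1) \<Longrightarrow> A *\<^sub>v (G *\<^sub>v g) = 0\<^sub>v k"
    and b: "b \<in> carrier_vec (q + 1)" "b \<noteq> 0\<^sub>v (q + 1)"
    and ker: "\<And>g. g \<in> carrier_vec (q + 1) \<Longrightarrow> G *\<^sub>v g = 0\<^sub>v (k + q) \<Longrightarrow> \<exists>s. g = s \<cdot>\<^sub>v b"
    and l: "l \<in> carrier_vec (k + q)" "G\<^sup>T *\<^sub>v l = 0\<^sub>v (q + 1)"
  obtains w where "w \<in> carrier_vec k" "l = A\<^sup>T *\<^sub>v w"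
proof -
  \<comment> \<open>The extra row \<open>b\<close> excludes the kernel of \<open>G\<close>, which
    lies in the line of \<open>b\<close>. The block matrix is square: \<open>k + q + 1\<close> rows
    and \<open>k + (q + 1)\<close> columns.\<close>
  define R where "R = mat_of_rows (q + 1) [b]"
  define F where "F = four_block_mat (A\<^sup>T) G (0\<^sub>m 1 k) R"
  have R: "R \<in> carrier_mat 1 (q + 1)" unfolding R_def by (rule carrier_matI) simp_all
  have Rg: "(R *\<^sub>v g) $ 0 = b \<bullet> g" if "g \<in> carrier_vec (q + 1)" for g
    using that b(1) by (simp add: R_def)
  have AT: "A\<^sup>T \<in> carrier_mat (k + q) k" using A by simp
  have F: "F \<in> carrier_mat (k + q + 1) (k + q + 1)"
    using four_block_carrier_mat[OF AT R, of G "0\<^sub>m 1 k"] by (simp add: F_def)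
  have Fv: "F *\<^sub>v (w @\<^sub>v g) = (A\<^sup>T *\<^sub>v w + G *\<^sub>v g) @\<^sub>v (R *\<^sub>v g)"
    if w: "w \<in> carrier_vec k" and g: "g \<in> carrier_vec (q + 1)" for w g
  proof -
    have "R *\<^sub>v g \<in> carrier_vec 1" using R g by (rule mult_mat_vec_carrier)
    moreover have "0\<^sub>m 1 k *\<^sub>v w = 0\<^sub>v 1" using w by (intro eq_vecI) auto
    ultimately have "0\<^sub>m 1 k *\<^sub>v w + R *\<^sub>v g = R *\<^sub>v g" by simp
    then show ?thesis
      unfolding F_def using four_block_mat_mult_vec[OF AT G _ R w g, of "0\<^sub>m 1 k"] by simp
  qed
  have split: "\<exists>w g. w \<in> carrier_vec k \<and> g \<in> carrier_vec (q + 1) \<and> x = w @\<^sub>v g"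
    if "x \<in> carrier_vec (k + q + 1)" for x :: "real vec"
    using vec_first_last_append[of x k "q + 1"] that vec_first_carrier vec_last_carrier
    by (metis add.assoc)
  \<comment> \<open>Applying \<open>A\<close> removes the second summand and leaves
    \<open>A A\<^sup>T w = 0\<close>: the ranges of \<open>A\<^sup>T\<close> and \<open>G\<close>
    are orthogonal.\<close>
  have cancel: "A\<^sup>T *\<^sub>v w = 0\<^sub>v (k + q)" if w: "w \<in> carrier_vec k" and g: "g \<in> carrier_vec (q + 1)"
    and 0: "A\<^sup>T *\<^sub>v w + G *\<^sub>v g = 0\<^sub>v (k + q)" for w g
  proof -
    have ATw: "A\<^sup>T *\<^sub>v w \<in> carrier_vec (k + q)" using AT w by (rule mult_mat_vec_carrier)
    have Gg: "G *\<^sub>v g \<in> carrier_vec (k + q)" using G g by (rule mult_mat_vec_carrier)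
    have "A *\<^sub>v (A\<^sup>T *\<^sub>v w + G *\<^sub>v g) = A *\<^sub>v (A\<^sup>T *\<^sub>v w) + 0\<^sub>v k"
      unfolding mult_add_distrib_mat_vec[OF A ATw Gg] AG[OF g] ..
    also have "A *\<^sub>v (A\<^sup>T *\<^sub>v w + G *\<^sub>v g) = 0\<^sub>v k" unfolding 0 using A by auto
    finally have "A\<^sup>T\<^sup>T *\<^sub>v (A\<^sup>T *\<^sub>v w) = 0\<^sub>v k"
      using mult_mat_vec_carrier[OF A ATw] by simp
    then show ?thesis by (rule transpose_mult_mat_vec_eq_0[OF AT w])
  qed
  have "x = 0\<^sub>v (k + q + 1)" if x: "x \<in> carrier_vec (k + q + 1)" and Fx: "F *\<^sub>v x = 0\<^sub>v (k + q + 1)" for x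
  proof -
    obtain w g where wg: "w \<in> carrier_vec k" "g \<in> carrier_vec (q + 1)" "x = w @\<^sub>v g"
      using split[OF x] by blast
    have ATw: "A\<^sup>T *\<^sub>v w \<in> carrier_vec (k + q)" using AT wg(1) by (rule mult_mat_vec_carrier)
    have Gg: "G *\<^sub>v g \<in> carrier_vec (k + q)" using G wg(2) by (rule mult_mat_vec_carrier)
    have z: "0\<^sub>v (k + q + 1) = 0\<^sub>v (k + q) @\<^sub>v (0\<^sub>v 1 :: real vec)" by auto
    have "(A\<^sup>T *\<^sub>v w + G *\<^sub>v g) @\<^sub>v (R *\<^sub>v g) = 0\<^sub>v (k + q) @\<^sub>v 0\<^sub>v 1"
      using Fx unfolding wg(3) Fv[OF wg(1,2)] z .
    then have 1: "A\<^sup>T *\<^sub>v w + G *\<^sub>v g = 0\<^sub>v (k + q)" and 2: "R *\<^sub>v g = 0\<^sub>v 1"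
      using append_vec_eq[of "A\<^sup>T *\<^sub>v w + G *\<^sub>v g" "k + q" "0\<^sub>v (k + q)"] ATw Gg by auto
    have w0: "A\<^sup>T *\<^sub>v w = 0\<^sub>v (k + q)" using cancel[OF wg(1,2) 1] .
    then have "w = 0\<^sub>v k" by (rule inj[OF wg(1)])
    have "G *\<^sub>v g = 0\<^sub>v (k + q)" using 1 w0 Gg by simp
    then obtain s where s: "g = s \<cdot>\<^sub>v b" using ker[OF wg(2)] by blast
    \<comment> \<open>The border row makes \<open>g = s b\<close> orthogonal to \<open>b\<close>,
      which forces \<open>s = 0\<close>.\<close>
    have "b \<bullet> g = 0" using Rg[OF wg(2)] 2 by simp
    then have "s * (b \<bullet> b) = 0" using s b by simp
    then have "s = 0" using scalar_prod_self_eq_0_iff[OF b(1)] b(2) by simp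
    then have "g = 0\<^sub>v (q + 1)" using s b(1) by auto
    then show ?thesis using \<open>w = 0\<^sub>v k\<close> wg(3) by auto
  qed
  moreover have "l @\<^sub>v 0\<^sub>v 1 \<in> carrier_vec (k + q + 1)" using l(1) by (intro append_carrier_vec) auto
  ultimately obtain x where x: "x \<in> carrier_vec (k + q + 1)" "F *\<^sub>v x = l @\<^sub>v 0\<^sub>v 1"
    using injective_square_mat_solvable[OF F] by metis
  obtain w g where wg: "w \<in> carrier_vec k" "g \<in> carrier_vec (q + 1)" "x = w @\<^sub>v g"
    using split[OF x(1)] by blast
  have ATw: "A\<^sup>T *\<^sub>v w \<in> carrier_vec (k + q)" using AT wg(1) by (rule mult_mat_vec_carrier)
  have Gg: "G *\<^sub>v g \<in> carrier_vec (k + q)" using G wg(2) by (rule mult_mat_vec_carrier)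
  have GT: "G\<^sup>T \<in> carrier_mat (q + 1) (k + q)" using G by simp
  have lwg: "A\<^sup>T *\<^sub>v w + G *\<^sub>v g = l"
    using x(2) append_vec_eq[of "A\<^sup>T *\<^sub>v w + G *\<^sub>v g" "k + q" l] ATw Gg l
    unfolding wg(3) Fv[OF wg(1,2)] by auto
  \<comment> \<open>Both \<open>l\<close> and \<open>A\<^sup>T w\<close> lie in the kernel of
    \<open>G\<^sup>T\<close>, so their difference \<open>G g\<close> does too; then
    \<open>G\<^sup>T G g = 0\<close> gives \<open>G g = 0\<close>.\<close>
  have "G\<^sup>T *\<^sub>v (A\<^sup>T *\<^sub>v w) = 0\<^sub>v (q + 1)"
    using A G AG wg(1) by (rule transpose_mult_eq_0)
  then have "G\<^sup>T *\<^sub>v (A\<^sup>T *\<^sub>v w + G *\<^sub>v g) = G\<^sup>T *\<^sub>v (G *\<^sub>v g)"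
    unfolding mult_add_distrib_mat_vec[OF GT ATw Gg]
    using mult_mat_vec_carrier[OF GT Gg] by simp
  then have "G\<^sup>T *\<^sub>v (G *\<^sub>v g) = 0\<^sub>v (q + 1)" using lwg l(2) by simp
  then have "G *\<^sub>v g = 0\<^sub>v (k + q)" by (rule transpose_mult_mat_vec_eq_0[OF G wg(2)])
  then have "l = A\<^sup>T *\<^sub>v w" using lwg ATw by simp
  then show thesis using that wg(1) by blast
qed

section \<open>Continuity of the norm and exact quadratic expansion of the objective\<close>

lemma tendsto_euclid_norm:
  assumes "\<And>t. x t \<in> carrier_vec n" "a \<in> carrier_vec n"
    and "\<And>j. j < n \<Longrightarrow> ((\<lambda>t. x t $ j) \<longlongrightarrow> a $ j) F"
  shows "((\<lambda>t. euclid_norm (x t)) \<longlongrightarrow> euclid_norm a) F"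
  unfolding euclid_norm_def by (intro tendsto_real_sqrt tendsto_scalar_prod[of _ n] assms)

lemma objective_along:
  assumes "y \<in> carrier_vec k" "x \<in> carrier_vec k" "u \<in> carrier_vec k"
  shows "objective y (x + t \<cdot>\<^sub>v u) = objective y x - t * ((y - x) \<bullet> u) + t\<^sup>2 / 2 * (u \<bullet> u)"
proof -
  have "(y - (x + t \<cdot>\<^sub>v u)) \<bullet> (y - (x + t \<cdot>\<^sub>v u))
      = (\<Sum>i\<in>{0..<k}. (y $ i - x $ i) * (y $ i - x $ i) - 2 * (t * ((y $ i - x $ i) * u $ i))
          + t\<^sup>2 * (u $ i * u $ i))"
    using assms by (auto simp: scalar_prod_def power2_eq_square algebra_simps intro!: sum.cong)
  also have "\<dots> = (y - x) \<bullet> (y - x) - 2 * (t * ((y - x) \<bullet> u)) + t\<^sup>2 * (u \<bullet> u)"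
    using assms by (simp add: scalar_prod_def sum.distrib sum_subtractf sum_distrib_left)
  finally show ?thesis by (simp add: objective_eq field_simps)
qed

subsection \<open>Divisors of polynomials\<close>


text \<open>Every sub-multiset is listed by some list over the support of \<open>B\<close> of length
  at most \<open>size B\<close>, and there are finitely many such lists.\<close>

lemma finite_submultisets: "finite {A. A \<subseteq># B}"
proof (rule finite_subset)
  show "{A. A \<subseteq># B} \<subseteq> mset ` {xs. set xs \<subseteq> set_mset B \<and> length xs \<le> size B}"
  proof
    fix A assume "A \<in> {A. A \<subseteq># B}"
    moreover obtain xs where "A = mset xs" by (metis ex_mset)
    ultimately show "A \<in> mset ` {xs. set xs \<subseteq> set_mset B \<and> length xs \<le> size B}"
      using set_mset_mono[of A B] size_mset_mono[of A B] by auto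
  qed
qed (simp add: finite_lists_length_le)

text \<open>Up to units a divisor is determined by its prime factorization, a sub-multiset of that
  of \<open>a\<close>.\<close>

lemma finite_normalized_divisors:
  fixes a :: "'a :: factorial_semiring"
  assumes "a \<noteq> 0"
  shows "finite (normalize ` {d. d dvd a})"
proof -
  have "inj_on prime_factorization (normalize ` {d. d dvd a})"
  proof (rule inj_onI)
    fix x y
    assume x: "x \<in> normalize ` {d. d dvd a}" and y: "y \<in> normalize ` {d. d dvd a}"
      and eq: "prime_factorization x = prime_factorization y"
    have "x \<noteq> 0" "y \<noteq> 0" using x y assms by auto
    then have "normalize x = normalize y" using eq prime_factorization_unique by blast
    then show "x = y" using x y by auto
  qed
  moreover have "prime_factorization ` normalize ` {d. d dvd a} \<subseteq> {A. A \<subseteq># prime_factorization a}"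
    using assms by (auto simp: prime_factorization_subset_iff_dvd)
  ultimately show ?thesis using finite_submultisets finite_imageD finite_subset by metis
qed

lemma dvd_same_degree_imp_smult:
  fixes p q :: "'a :: field poly"
  assumes deg: "degree p = degree q" and dvd: "p dvd q"
  obtains s where "q = Polynomial.smult s p"
proof -
  obtain u where u: "q = p * u" using dvd by (auto elim: dvdE)
  show thesis
  proof (cases "q = 0")
    case False
    then have "p \<noteq> 0" "u \<noteq> 0" using u by auto
    then have "degree u = 0" using deg u by (simp add: degree_mult_eq)
    then obtain s where "u = [:s:]" by (rule degree_eq_zeroE)
    then show thesis using that[of s] u by simp
  qed (use that[of 0] in simp)
qed

text \<open>\<open>indep\<close> makes members of the pencil with different parameters
  non-associated, whereas a nonzero \<open>p\<close> has only finitely many divisors up to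
  units.\<close>

lemma pencil_common_multiple_eq_0:
  fixes b d :: "real poly" and p :: "real poly"
  assumes indep: "\<And>s t t'. b + Polynomial.smult t' d = Polynomial.smult s (b + Polynomial.smult t d) \<Longrightarrow> t = t'"
    and inf: "infinite S" and dvd: "\<And>t. t \<in> S \<Longrightarrow> b + Polynomial.smult t d dvd p"
  shows "p = 0"
proof (rule ccontr)
  assume p: "p \<noteq> 0"
  have "inj_on (\<lambda>t. normalize (b + Polynomial.smult t d)) S"
  proof (rule inj_onI)
    fix t t' assume "normalize (b + Polynomial.smult t d) = normalize (b + Polynomial.smult t' d)"
    then have dvd: "b + Polynomial.smult t d dvd b + Polynomial.smult t' d"
      "b + Polynomial.smult t' d dvd b + Polynomial.smult t d"
      by (auto dest: associatedD1 associatedD2)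
    \<comment> \<open>Mutual divisors have equal degree, also in the zero case, where both vanish.
      The quotient is then a constant.\<close>
    then have "degree (b + Polynomial.smult t d) = degree (b + Polynomial.smult t' d)"
      by (metis dvd_0_left dvd_imp_degree_le order_antisym)
    then obtain s where "b + Polynomial.smult t' d = Polynomial.smult s (b + Polynomial.smult t d)"
      using dvd(1) by (rule dvd_same_degree_imp_smult)
    then show "t = t'" by (rule indep)
  qed
  moreover have "(\<lambda>t. normalize (b + Polynomial.smult t d)) ` S \<subseteq> normalize ` {u. u dvd p}"
    using dvd by auto
  then have "finite ((\<lambda>t. normalize (b + Polynomial.smult t d)) ` S)"
    using finite_normalized_divisors[OF p] finite_subset by blast
  ultimately show False using inf finite_imageD by blast
qed

subsection \<open>Toeplitz matrices and polynomial multiplication\<close>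

text \<open>Coefficient vectors \<open>(v\<^sub>d, \<dots>, v\<^sub>0)\<close> begin with the
  constant term of \<open>v(z) = v\<^sub>0 z\<^sup>d + \<dots> + v\<^sub>d\<close>, so reading index
  \<open>j\<close> as the power \<open>z\<^sup>j\<close> gives \<open>v(z)\<close> without
  reversal.\<close>

definition vec_poly :: "'a :: zero vec \<Rightarrow> 'a poly" where
  "vec_poly v = Poly (list_of_vec v)"

lemma coeff_vec_poly: "coeff (vec_poly v) i = (if i < dim_vec v then v $ i else 0)"
  by (simp add: vec_poly_def nth_default_def list_of_vec_index)

lemma vec_poly_eq_0_iff: "vec_poly v = 0 \<longleftrightarrow> v = 0\<^sub>v (dim_vec v)"
  by (auto simp: poly_eq_iff coeff_vec_poly vec_eq_iff)

lemma vec_poly_add_smult: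
  fixes v :: "'a :: comm_ring_1 vec"
  assumes "dim_vec w = dim_vec v"
  shows "vec_poly (v + t \<cdot>\<^sub>v w) = vec_poly v + Polynomial.smult t (vec_poly w)"
  using assms by (intro poly_eqI) (simp add: coeff_vec_poly)

lemma toeplitz_mult_index:
  assumes v: "v \<in> carrier_vec (d + 1)" and x: "x \<in> carrier_vec (k + d)" and i: "i < k"
  shows "(toeplitz k v *\<^sub>v x) $ i = (\<Sum>s\<le>d. v $ s * x $ (i + s))"
proof -
  have "(toeplitz k v *\<^sub>v x) $ i = (\<Sum>s\<in>{0..<d + 1}. x $ (i + s) * v $ s)"
    unfolding toeplitz_mult_eq_hankel_mult[OF v x]
    using i v by (simp add: hankel_def scalar_prod_def)
  also have "{0..<d + 1} = {..d}" by auto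
  finally show ?thesis by (simp add: mult.commute)
qed

lemma toeplitz_mult_carrier:
  assumes "v \<in> carrier_vec (d + 1)" "x \<in> carrier_vec (k + d)"
  shows "toeplitz k v *\<^sub>v x \<in> carrier_vec k"
  using toeplitz_carrier[OF assms(1)] assms(2) by (rule mult_mat_vec_carrier)

text \<open>Both sides apply the coefficients of the product polynomial to \<open>x\<close>, so only
  a double sum is reordered. The row counts differ because the two factors shorten their arguments
  by \<open>d\<close> and \<open>d'\<close>.\<close>

lemma toeplitz_commute:
  assumes u: "u \<in> carrier_vec (d + 1)" and w: "w \<in> carrier_vec (d' + 1)"
    and x: "x \<in> carrier_vec (k + d + d')"
  shows "toeplitz k u *\<^sub>v (toeplitz (k + d) w *\<^sub>v x) = toeplitz k w *\<^sub>v (toeplitz (k + d') u *\<^sub>v x)"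
proof (rule eq_vecI)
  have x': "x \<in> carrier_vec (k + d' + d)" using x by (simp add: ac_simps)
  have wx: "toeplitz (k + d) w *\<^sub>v x \<in> carrier_vec (k + d)"
    using w x by (rule toeplitz_mult_carrier)
  have ux: "toeplitz (k + d') u *\<^sub>v x \<in> carrier_vec (k + d')"
    using u x' by (rule toeplitz_mult_carrier)
  fix i assume "i < dim_vec (toeplitz k w *\<^sub>v (toeplitz (k + d') u *\<^sub>v x))"
  then have i: "i < k" by (simp add: toeplitz_def)
  have "(toeplitz k u *\<^sub>v (toeplitz (k + d) w *\<^sub>v x)) $ i
      = (\<Sum>s\<le>d. u $ s * (\<Sum>r\<le>d'. w $ r * x $ (i + s + r)))"
    unfolding toeplitz_mult_index[OF u wx i]
    using i by (intro sum.cong refl) (simp add: toeplitz_mult_index[OF w x] del: index_mult_mat_vec)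
  also have "\<dots> = (\<Sum>r\<le>d'. w $ r * (\<Sum>s\<le>d. u $ s * x $ (i + r + s)))"
    unfolding sum_distrib_left by (subst sum.swap) (simp add: ac_simps)
  also have "\<dots> = (toeplitz k w *\<^sub>v (toeplitz (k + d') u *\<^sub>v x)) $ i"
    unfolding toeplitz_mult_index[OF w ux i]
    using i by (intro sum.cong refl) (simp add: toeplitz_mult_index[OF u x'] del: index_mult_mat_vec)
  finally show "(toeplitz k u *\<^sub>v (toeplitz (k + d) w *\<^sub>v x)) $ i
      = (toeplitz k w *\<^sub>v (toeplitz (k + d') u *\<^sub>v x)) $ i" .
qed (simp add: toeplitz_def)

text \<open>Row \<open>i\<close> of the Toeplitz matrix holds the coefficients of
  \<open>z\<^sup>i v(z)\<close>, and the transpose combines the rows with the weights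
  \<open>l\<^sub>i\<close>.\<close>

lemma vec_poly_transpose_toeplitz:
  assumes v: "v \<in> carrier_vec (d + 1)" and l: "l \<in> carrier_vec k"
  shows "vec_poly ((toeplitz k v)\<^sup>T *\<^sub>v l) = vec_poly l * vec_poly v"
proof (rule poly_eqI)
  fix j
  have R: "coeff (vec_poly l * vec_poly v) j
      = (\<Sum>i\<le>j. (if i < k then l $ i else 0) * (if j - i < d + 1 then v $ (j - i) else 0))"
    using v l by (simp add: coeff_mult coeff_vec_poly)
  show "coeff (vec_poly ((toeplitz k v)\<^sup>T *\<^sub>v l)) j = coeff (vec_poly l * vec_poly v) j"
  proof (cases "j < k + d")
    case True
    have "coeff (vec_poly ((toeplitz k v)\<^sup>T *\<^sub>v l)) j
        = (\<Sum>i\<in>{0..<k}. (if i \<le> j \<and> j < i + (d + 1) then v $ (j - i) else 0) * l $ i)"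
      using True v l by (simp add: coeff_vec_poly toeplitz_def scalar_prod_def)
    also have "\<dots> = (\<Sum>i\<in>{0..<k} \<inter> {..j}. (if j - i < d + 1 then v $ (j - i) else 0) * l $ i)"
      by (intro sum.mono_neutral_cong_right) auto
    also have "\<dots> = (\<Sum>i\<le>j. (if i < k then l $ i else 0) * (if j - i < d + 1 then v $ (j - i) else 0))"
      by (intro sum.mono_neutral_cong_left) auto
    finally show ?thesis using R by simp
  next
    case False
    \<comment> \<open>For \<open>j \<ge> k + d\<close> the conditions \<open>i < k\<close> and
      \<open>j - i \<le> d\<close> exclude each other, so the product has no coefficient beyond the
      dimension of the vector.\<close>
    then have "(if i < k then l $ i else 0) * (if j - i < d + 1 then v $ (j - i) else 0) = 0" for i
      by auto
    then have "coeff (vec_poly l * vec_poly v) j = 0" using R by simp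
    moreover have "\<not> j < dim_vec ((toeplitz k v)\<^sup>T *\<^sub>v l)" using False v by (simp add: toeplitz_def)
    ultimately show ?thesis by (simp add: coeff_vec_poly)
  qed
qed

lemma transpose_toeplitz_injective:
  assumes v: "v \<in> carrier_vec (d + 1)" "v \<noteq> 0\<^sub>v (d + 1)" and l: "l \<in> carrier_vec k"
    and 0: "(toeplitz k v)\<^sup>T *\<^sub>v l = 0\<^sub>v (k + d)"
  shows "l = 0\<^sub>v k"
proof -
  have "vec_poly l * vec_poly v = 0"
    unfolding vec_poly_transpose_toeplitz[OF v(1) l, symmetric] 0 by (simp add: vec_poly_eq_0_iff)
  moreover have "vec_poly v \<noteq> 0" using v by (simp add: vec_poly_eq_0_iff)
  ultimately show ?thesis using l by (simp add: vec_poly_eq_0_iff)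
qed

lemma toeplitz_add_smult:
  assumes "b \<in> carrier_vec (d + 1)" "b' \<in> carrier_vec (d + 1)"
  shows "toeplitz k (b + t \<cdot>\<^sub>v b') = toeplitz k b + t \<cdot>\<^sub>m toeplitz k b'"
  using assms by (intro eq_matI) (auto simp: toeplitz_def)

text \<open>The pole polynomial is monic of degree \<open>m\<close>, so the last entry is 1.\<close>

lemma pole_coeffs_nonzero: "pole_coeffs m p \<noteq> 0\<^sub>v (m + 1)"
proof -
  have "lead_coeff (pole_poly m p) = 1" by (simp add: pole_poly_def lead_coeff_prod)
  moreover have "degree (pole_poly m p) = m"
    unfolding pole_poly_def by (subst degree_prod_eq_sum_degree) auto
  ultimately have "pole_coeffs m p $ m = 1" by (simp add: pole_coeffs_def)
  then show ?thesis by auto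
qed

subsection \<open>Eigenvalues and critical points\<close>

text \<open>Here \<open>k\<close> stands for \<open>N - 2 * n + m\<close>. Writing \<open>n\<close>
  and \<open>N\<close> as sums in \<open>k\<close>, \<open>q\<close>, \<open>m\<close> avoids
  truncated subtraction, and \<open>2 * n < N\<close> becomes \<open>m < k\<close>.\<close>

locale fixed_pole_realization =
  fixes N n m q k :: nat and c y e :: "real vec"
  assumes q_pos: "0 < q" and m_less_k: "m < k"
    and n_eq: "n = q + m" and N_eq: "N = k + q + m + q"
    and c: "c \<in> carrier_vec (m + 1)" and c_nz: "c \<noteq> 0\<^sub>v (m + 1)"
    and y: "y \<in> carrier_vec N" and e: "e \<in> carrier_vec (q + 1)"
begin

abbreviation (input) "C \<equiv> toeplitz (k + q) c"
abbreviation (input) "T \<equiv> toeplitz_cb N n m c"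
abbreviation (input) "B \<equiv> toeplitz k"
abbreviation (input) "F \<equiv> feasible N n m c e"

text \<open>For fixed \<open>x\<close> the constraint \<open>T b x\<close> is linear in
  \<open>b\<close>; this is the matrix of that linear map, hence the derivative of the constraint
  with respect to \<open>b\<close>.\<close>

definition G :: "real vec \<Rightarrow> real mat" where
  "G x = C * hankel (k + q + m) (q + 1) x"

section \<open>Dimensions and product identities\<close>

lemma dims [simp]:
  "N - n = k + q" "n - m = q" "N - (n - m) = k + q + m" "N - q = k + q + m" "N - 2 * n + m = k"
  using m_less_k by (auto simp: n_eq N_eq)

lemma m_less_n: "m < n" and n_less_N: "2 * n < N"
  using q_pos m_less_k by (auto simp: n_eq N_eq)

lemma C: "C \<in> carrier_mat (k + q) (k + q + m)"
  by (rule toeplitz_carrier[OF c])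

lemma S: "b \<in> carrier_vec (q + 1) \<Longrightarrow> toeplitz (k + q + m) b \<in> carrier_mat (k + q + m) N"
  unfolding N_eq by (rule toeplitz_carrier)

lemma B: "b \<in> carrier_vec (q + 1) \<Longrightarrow> B b \<in> carrier_mat k (k + q)"
  by (rule toeplitz_carrier)

lemma T: "b \<in> carrier_vec (q + 1) \<Longrightarrow> T b \<in> carrier_mat (k + q) N"
  using toeplitz_cb_carrier[OF m_less_n n_less_N c, of b] by simp

lemma G: "G x \<in> carrier_mat (k + q) (q + 1)"
  unfolding G_def by (rule mult_carrier_mat[OF C]) (simp add: hankel_def)

lemma T_eq: "T b = C * toeplitz (k + q + m) b"
  by (simp add: toeplitz_cb_def)

lemma T_mult:
  assumes "b \<in> carrier_vec (q + 1)" "x \<in> carrier_vec N"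
  shows "T b *\<^sub>v x = C *\<^sub>v (toeplitz (k + q + m) b *\<^sub>v x)"
  unfolding T_eq using C S[OF assms(1)] assms(2) by (rule assoc_mult_mat_vec)

lemma G_mult:
  assumes b: "b \<in> carrier_vec (q + 1)" and x: "x \<in> carrier_vec N"
  shows "G x *\<^sub>v b = T b *\<^sub>v x"
proof -
  have "hankel (k + q + m) (q + 1) x \<in> carrier_mat (k + q + m) (q + 1)" by (simp add: hankel_def)
  then have "G x *\<^sub>v b = C *\<^sub>v (hankel (k + q + m) (q + 1) x *\<^sub>v b)"
    unfolding G_def using C b by (intro assoc_mult_mat_vec)
  also have "hankel (k + q + m) (q + 1) x *\<^sub>v b = toeplitz (k + q + m) b *\<^sub>v x"
    using toeplitz_mult_eq_hankel_mult[OF b, of x "k + q + m"] x by (simp add: N_eq)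
  finally show ?thesis using T_mult[OF b x] by simp
qed

lemma transpose_T_mult:
  assumes b: "b \<in> carrier_vec (q + 1)" and l: "l \<in> carrier_vec (k + q)"
  shows "(T b)\<^sup>T *\<^sub>v l = (toeplitz (k + q + m) b)\<^sup>T *\<^sub>v (C\<^sup>T *\<^sub>v l)"
  unfolding T_eq transpose_mult[OF C S[OF b]]
  using C S[OF b] l by (intro assoc_mult_mat_vec) auto

lemma vec_poly_transpose_T:
  assumes b: "b \<in> carrier_vec (q + 1)" and l: "l \<in> carrier_vec (k + q)"
  shows "vec_poly ((T b)\<^sup>T *\<^sub>v l) = vec_poly l * vec_poly c * vec_poly b"
proof -
  have "C\<^sup>T *\<^sub>v l \<in> carrier_vec (k + q + m)" using C l by simp
  then show ?thesis
    unfolding transpose_T_mult[OF b l]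
    by (simp add: vec_poly_transpose_toeplitz[OF b] vec_poly_transpose_toeplitz[OF c l])
qed

lemma transpose_T_injective:
  assumes b: "b \<in> carrier_vec (q + 1)" "b \<noteq> 0\<^sub>v (q + 1)" and l: "l \<in> carrier_vec (k + q)"
    and 0: "(T b)\<^sup>T *\<^sub>v l = 0\<^sub>v N"
  shows "l = 0\<^sub>v (k + q)"
proof -
  have "vec_poly l * vec_poly c * vec_poly b = 0"
    unfolding vec_poly_transpose_T[OF b(1) l, symmetric] 0 by (simp add: vec_poly_eq_0_iff)
  then show ?thesis using b c c_nz l by (simp add: vec_poly_eq_0_iff)
qed

text \<open>With \<open>G x g = T\<^sup>c T\<^sup>g x\<close>, the factor \<open>T\<^sup>b\<close>
  commutes past \<open>T\<^sup>c\<close> and \<open>T\<^sup>g\<close> until it meets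
  \<open>x\<close>. Moving \<open>T\<^sup>g\<close> to the front then exposes
  \<open>T\<^sup>c T\<^sup>b x = 0\<close>.\<close>

lemma B_G_mult:
  assumes b: "b \<in> carrier_vec (q + 1)" and x: "x \<in> carrier_vec N" and Tx: "T b *\<^sub>v x = 0\<^sub>v (k + q)"
    and g: "g \<in> carrier_vec (q + 1)"
  shows "B b *\<^sub>v (G x *\<^sub>v g) = 0\<^sub>v k"
proof -
  have x': "x \<in> carrier_vec (k + m + q + q)" "x \<in> carrier_vec (k + q + m + q)"
    using x by (simp_all add: N_eq ac_simps)
  have gx: "toeplitz (k + q + m) g *\<^sub>v x \<in> carrier_vec (k + q + m)"
    using toeplitz_mult_carrier[OF g x'(2)] .
  have bx: "toeplitz (k + q + m) b *\<^sub>v x \<in> carrier_vec (k + m + q)"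
    using toeplitz_mult_carrier[OF b x'(2)] by (simp add: ac_simps)
  have "B b *\<^sub>v (G x *\<^sub>v g) = B b *\<^sub>v (C *\<^sub>v (toeplitz (k + q + m) g *\<^sub>v x))"
    using G_mult[OF g x] T_mult[OF g x] by simp
  also have "\<dots> = toeplitz k c *\<^sub>v (toeplitz (k + m) b *\<^sub>v (toeplitz (k + m + q) g *\<^sub>v x))"
    using toeplitz_commute[OF b c gx] by (simp add: ac_simps)
  also have "\<dots> = toeplitz k c *\<^sub>v (toeplitz (k + m) g *\<^sub>v (toeplitz (k + m + q) b *\<^sub>v x))"
    using toeplitz_commute[OF b g x'(1)] by simp
  also have "\<dots> = B g *\<^sub>v (C *\<^sub>v (toeplitz (k + m + q) b *\<^sub>v x))"
    using toeplitz_commute[OF c g, of "toeplitz (k + q + m) b *\<^sub>v x" k] bx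
    by (simp add: ac_simps)
  also have "C *\<^sub>v (toeplitz (k + m + q) b *\<^sub>v x) = 0\<^sub>v (k + q)"
    using T_mult[OF b x] Tx by (simp add: ac_simps)
  also have "B g *\<^sub>v 0\<^sub>v (k + q) = 0\<^sub>v k" using B[OF g] by auto
  finally show ?thesis .
qed

lemma normalized_nonzero:
  assumes "b \<bullet> e = 1"
  shows "b \<noteq> 0\<^sub>v (q + 1)"
  using assms e by auto

section \<open>The eigenvalue problem as solvability of a linear system\<close>

lemma mep_matrix_mult:
  assumes b: "b \<in> carrier_vec (q + 1)" and w: "w \<in> carrier_vec k"
  shows "mep_matrix N n m c y b *\<^sub>v vCons a w
    = a \<cdot>\<^sub>v (T b *\<^sub>v y) + (T b * (T b)\<^sup>T) *\<^sub>v ((B b)\<^sup>T *\<^sub>v w)"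
proof -
  define P where "P = T b * (T b)\<^sup>T * (B b)\<^sup>T"
  have TT: "T b * (T b)\<^sup>T \<in> carrier_mat (k + q) (k + q)"
    using T[OF b] by (intro mult_carrier_mat[of _ _ N]) auto
  have BT: "(B b)\<^sup>T \<in> carrier_mat (k + q) k" using B[OF b] by simp
  have P: "P \<in> carrier_mat (k + q) k"
    unfolding P_def using TT BT by (rule mult_carrier_mat)
  have "mat_of_cols (k + q) ((T b *\<^sub>v y) # cols P) *\<^sub>v vCons a w = a \<cdot>\<^sub>v (T b *\<^sub>v y) + P *\<^sub>v w"
  proof (rule eq_vecI)
    fix i assume "i < dim_vec (a \<cdot>\<^sub>v (T b *\<^sub>v y) + P *\<^sub>v w)"
    then have i: "i < k + q" using P by simp
    have "row (mat_of_cols (k + q) ((T b *\<^sub>v y) # cols P)) i = vCons ((T b *\<^sub>v y) $ i) (row P i)"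
      (is "?r = _")
    proof (rule eq_vecI)
      fix j assume "j < dim_vec (vCons ((T b *\<^sub>v y) $ i) (row P i))"
      then have "j < Suc k" using P by simp
      then show "?r $ j = vCons ((T b *\<^sub>v y) $ i) (row P i) $ j"
        using P i by (cases j) (auto simp: mat_of_cols_index simp del: index_mult_mat_vec)
    qed (use P in simp)
    moreover have "dim_vec (T b *\<^sub>v y) = k + q" "dim_vec (P *\<^sub>v w) = k + q"
      "(P *\<^sub>v w) $ i = row P i \<bullet> w"
      using T[OF b] P i by auto
    ultimately show "(mat_of_cols (k + q) ((T b *\<^sub>v y) # cols P) *\<^sub>v vCons a w) $ i
        = (a \<cdot>\<^sub>v (T b *\<^sub>v y) + P *\<^sub>v w) $ i"
      using i by (simp del: dim_mult_mat_vec)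
  qed (use P in simp)
  moreover have "P *\<^sub>v w = (T b * (T b)\<^sup>T) *\<^sub>v ((B b)\<^sup>T *\<^sub>v w)"
    unfolding P_def using TT BT w by (rule assoc_mult_mat_vec)
  ultimately show ?thesis by (simp add: mep_matrix_def P_def Let_def)
qed

text \<open>Split a kernel vector into its first entry \<open>a\<close> and the rest
  \<open>w\<close>. If \<open>a = 0\<close>, injectivity of the Gram matrix and of
  \<open>(B b)\<^sup>T\<close> gives \<open>w = 0\<close>; so \<open>a \<noteq> 0\<close>, and
  scaling the first entry to -1 yields the equation.\<close>

lemma eigenvalue_iff:
  "real_affine_eigenvalue N n m c y e b \<longleftrightarrow>
     b \<in> carrier_vec (q + 1) \<and> b \<bullet> e = 1 \<and>
     (\<exists>w \<in> carrier_vec k. T b *\<^sub>v y = (T b * (T b)\<^sup>T) *\<^sub>v ((B b)\<^sup>T *\<^sub>v w))"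
proof (cases "b \<in> carrier_vec (q + 1) \<and> b \<bullet> e = 1")
  case False
  then show ?thesis unfolding real_affine_eigenvalue_def by auto
next
  case True
  then have b: "b \<in> carrier_vec (q + 1)" and b_nz: "b \<noteq> 0\<^sub>v (q + 1)" using normalized_nonzero by auto
  define K where "K = T b * (T b)\<^sup>T"
  have K: "K \<in> carrier_mat (k + q) (k + q)"
    unfolding K_def using T[OF b] by (intro mult_carrier_mat[of _ _ N]) auto
  have Ty: "T b *\<^sub>v y \<in> carrier_vec (k + q)" using T[OF b] y by (rule mult_mat_vec_carrier)
  have Bw: "(B b)\<^sup>T *\<^sub>v w \<in> carrier_vec (k + q)" if "w \<in> carrier_vec k" for w
    using B[OF b] that by simp
  have KBw: "K *\<^sub>v ((B b)\<^sup>T *\<^sub>v w) \<in> carrier_vec (k + q)" if "w \<in> carrier_vec k" for w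
    using K Bw[OF that] by (rule mult_mat_vec_carrier)
  have mult: "mep_matrix N n m c y b *\<^sub>v vCons a w = a \<cdot>\<^sub>v (T b *\<^sub>v y) + K *\<^sub>v ((B b)\<^sup>T *\<^sub>v w)"
    if "w \<in> carrier_vec k" for a w
    unfolding K_def by (rule mep_matrix_mult[OF b that])
  have scale: "K *\<^sub>v ((B b)\<^sup>T *\<^sub>v (s \<cdot>\<^sub>v w)) = s \<cdot>\<^sub>v (K *\<^sub>v ((B b)\<^sup>T *\<^sub>v w))"
    if "w \<in> carrier_vec k" for s w
  proof -
    have "(B b)\<^sup>T \<in> carrier_mat (k + q) k" using B[OF b] by simp
    from mult_mat_vec[OF this that] mult_mat_vec[OF K Bw[OF that]] show ?thesis by simp
  qed
  have "real_affine_eigenvalue N n m c y e b \<longleftrightarrow>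
      (\<exists>v \<in> carrier_vec (k + 1). v \<noteq> 0\<^sub>v (k + 1) \<and> mep_matrix N n m c y b *\<^sub>v v = 0\<^sub>v (k + q))"
    using rank_deficient_iff[OF mep_matrix_carrier[OF m_less_n n_less_N c, of b]] True
    unfolding real_affine_eigenvalue_def by simp
  also have "\<dots> \<longleftrightarrow> (\<exists>w \<in> carrier_vec k. T b *\<^sub>v y = K *\<^sub>v ((B b)\<^sup>T *\<^sub>v w))"
  proof
    assume "\<exists>v \<in> carrier_vec (k + 1). v \<noteq> 0\<^sub>v (k + 1) \<and> mep_matrix N n m c y b *\<^sub>v v = 0\<^sub>v (k + q)"
    then obtain v where v: "v \<in> carrier_vec (Suc k)" "v \<noteq> 0\<^sub>v (Suc k)"
      "mep_matrix N n m c y b *\<^sub>v v = 0\<^sub>v (k + q)" by auto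
    obtain a w where aw: "v = vCons a w" using v(1) by (cases v) auto
    have w: "w \<in> carrier_vec k" using v(1) aw by simp
    have 0: "a \<cdot>\<^sub>v (T b *\<^sub>v y) + K *\<^sub>v ((B b)\<^sup>T *\<^sub>v w) = 0\<^sub>v (k + q)"
      using v(3) mult[OF w] aw by simp
    have "a \<noteq> 0"
    proof
      assume a: "a = 0"
      have "0 \<cdot>\<^sub>v (T b *\<^sub>v y) = 0\<^sub>v (k + q)"
        using carrier_vecD[OF Ty]
        by (intro eq_vecI) (simp_all del: index_mult_mat_vec dim_mult_mat_vec)
      then have "K *\<^sub>v ((B b)\<^sup>T *\<^sub>v w) = 0\<^sub>v (k + q)" using 0 KBw[OF w] a by simp
      then have "(B b)\<^sup>T *\<^sub>v w = 0\<^sub>v (k + q)"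
        unfolding K_def using gram_injective[OF T[OF b] _ Bw[OF w]] transpose_T_injective[OF b b_nz]
        by blast
      then have "w = 0\<^sub>v k" by (rule transpose_toeplitz_injective[OF b b_nz w])
      then show False using v(2) a aw by (simp add: zero_vec_Suc)
    qed
    have "T b *\<^sub>v y = (- 1 / a) \<cdot>\<^sub>v (K *\<^sub>v ((B b)\<^sup>T *\<^sub>v w))"
    proof (rule eq_vecI)
      fix i assume "i < dim_vec ((- 1 / a) \<cdot>\<^sub>v (K *\<^sub>v ((B b)\<^sup>T *\<^sub>v w)))"
      then have i: "i < k + q" using K by simp
      have "(a \<cdot>\<^sub>v (T b *\<^sub>v y) + K *\<^sub>v ((B b)\<^sup>T *\<^sub>v w)) $ i = 0" using 0 i by simp
      then have "a * (T b *\<^sub>v y) $ i + (K *\<^sub>v ((B b)\<^sup>T *\<^sub>v w)) $ i = 0"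
        using i carrier_vecD[OF Ty] carrier_vecD[OF KBw[OF w]]
        by (simp del: index_mult_mat_vec dim_mult_mat_vec)
      then show "(T b *\<^sub>v y) $ i = ((- 1 / a) \<cdot>\<^sub>v (K *\<^sub>v ((B b)\<^sup>T *\<^sub>v w))) $ i"
        using i \<open>a \<noteq> 0\<close> carrier_vecD[OF KBw[OF w]]
        by (simp del: index_mult_mat_vec dim_mult_mat_vec add: field_simps)
    qed (use carrier_vecD[OF Ty] carrier_vecD[OF KBw[OF w]] in \<open>simp del: dim_mult_mat_vec\<close>)
    then have "T b *\<^sub>v y = K *\<^sub>v ((B b)\<^sup>T *\<^sub>v ((- 1 / a) \<cdot>\<^sub>v w))" using scale[OF w] by simp
    then show "\<exists>w \<in> carrier_vec k. T b *\<^sub>v y = K *\<^sub>v ((B b)\<^sup>T *\<^sub>v w)"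
      using w by (intro bexI[of _ "(- 1 / a) \<cdot>\<^sub>v w"]) auto
  next
    assume "\<exists>w \<in> carrier_vec k. T b *\<^sub>v y = K *\<^sub>v ((B b)\<^sup>T *\<^sub>v w)"
    then obtain w where w: "w \<in> carrier_vec k" "T b *\<^sub>v y = K *\<^sub>v ((B b)\<^sup>T *\<^sub>v w)" by blast
    have "mep_matrix N n m c y b *\<^sub>v vCons (- 1) w = 0\<^sub>v (k + q)"
      unfolding mult[OF w(1)] w(2) using carrier_vecD[OF KBw[OF w(1)]]
      by (intro eq_vecI) (simp_all del: index_mult_mat_vec dim_mult_mat_vec)
    moreover have "vCons (- 1) w \<noteq> 0\<^sub>v (Suc k)" by (simp add: zero_vec_Suc)
    ultimately show "\<exists>v \<in> carrier_vec (k + 1). v \<noteq> 0\<^sub>v (k + 1) \<and> mep_matrix N n m c y b *\<^sub>v v = 0\<^sub>v (k + q)"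
      using w(1) by (intro bexI[of _ "vCons (- 1) w"]) auto
  qed
  finally show ?thesis using True by (simp add: K_def)
qed

lemma eigenvalue_imp_critical_point:
  assumes "real_affine_eigenvalue N n m c y e b"
  shows "\<exists>yh lam mu. critical_point N n m c y e b yh lam mu"
proof -
  obtain w where b: "b \<in> carrier_vec (q + 1)" and be: "b \<bullet> e = 1" and w: "w \<in> carrier_vec k"
    and Ty: "T b *\<^sub>v y = (T b * (T b)\<^sup>T) *\<^sub>v ((B b)\<^sup>T *\<^sub>v w)"
    using assms unfolding eigenvalue_iff by blast
  define l where "l = (B b)\<^sup>T *\<^sub>v w"
  have l: "l \<in> carrier_vec (k + q)" unfolding l_def using B[OF b] w by simp
  define x where "x = y - (T b)\<^sup>T *\<^sub>v l"
  have TTl: "(T b)\<^sup>T *\<^sub>v l \<in> carrier_vec N" using T[OF b] l by simp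
  have x: "x \<in> carrier_vec N" unfolding x_def using y TTl by simp
  have "T b *\<^sub>v x = T b *\<^sub>v y - T b *\<^sub>v ((T b)\<^sup>T *\<^sub>v l)"
    unfolding x_def using T[OF b] y TTl by (rule mult_minus_distrib_mat_vec)
  also have "T b *\<^sub>v ((T b)\<^sup>T *\<^sub>v l) = T b *\<^sub>v y"
    unfolding Ty l_def[symmetric] using T[OF b] l by (intro assoc_mult_mat_vec[symmetric]) auto
  finally have Tx: "T b *\<^sub>v x = 0\<^sub>v (k + q)"
    using mult_mat_vec_carrier[OF T[OF b] y] by simp
  \<comment> \<open>This is stationarity in \<open>b\<close> with \<open>mu = 0\<close>; it holds
    because \<open>l\<close> lies in the range of \<open>(B b)\<^sup>T\<close> and
    \<open>B b\<close> annihilates the columns of \<open>G x\<close>.\<close>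
  have "(G x)\<^sup>T *\<^sub>v l = 0\<^sub>v (q + 1)"
    unfolding l_def using B[OF b] G B_G_mult[OF b x Tx] w by (rule transpose_mult_eq_0)
  moreover have "(G x)\<^sup>T *\<^sub>v l = (hankel (k + q + m) (q + 1) x)\<^sup>T *\<^sub>v (C\<^sup>T *\<^sub>v l)"
  proof -
    have H: "hankel (k + q + m) (q + 1) x \<in> carrier_mat (k + q + m) (q + 1)" by (simp add: hankel_def)
    show ?thesis
      unfolding G_def transpose_mult[OF C H] using C H l by (intro assoc_mult_mat_vec) auto
  qed
  moreover have "x - y + (T b)\<^sup>T *\<^sub>v l = 0\<^sub>v N"
    unfolding x_def using carrier_vecD[OF y] carrier_vecD[OF TTl]
    by (intro eq_vecI) (simp_all del: index_mult_mat_vec dim_mult_mat_vec)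
  ultimately have "critical_point N n m c y e b x l 0"
    unfolding critical_point_iff[OF m_less_n n_less_N c y e[folded dims(2)]] dims
    using b x l be Tx T_mult[OF b x] transpose_T_mult[OF b l] e by auto
  then show ?thesis by blast
qed

subsection \<open>Local minimizers\<close>

lemma T_add_smult:
  assumes b: "b \<in> carrier_vec (q + 1)" and d: "d \<in> carrier_vec (q + 1)"
  shows "T (b + t \<cdot>\<^sub>v d) = T b + t \<cdot>\<^sub>m T d"
  unfolding T_eq toeplitz_add_smult[OF b d]
  using mult_add_distrib_mat[OF C S[OF b], of "t \<cdot>\<^sub>m toeplitz (k + q + m) d"]
    mult_smult_distrib[OF C S[OF d]] S[OF d] by simp

lemma feasible_iff:
  "F b x \<longleftrightarrow> b \<in> carrier_vec (q + 1) \<and> x \<in> carrier_vec N \<and> T b *\<^sub>v x = 0\<^sub>v (k + q) \<and> b \<bullet> e = 1"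
  unfolding feasible_def dims ..

text \<open>
  The centre \<open>b\<^sub>0\<close> may differ from the point \<open>b\<close> itself, so that the conditions below also apply to
  all feasible \<open>(b, x)\<close> with \<open>b\<close> near a local minimizer \<open>(b\<^sub>0, x)\<close>: they are local minimizers, too.
\<close>

definition minimal_near :: "real \<Rightarrow> real vec \<Rightarrow> real vec \<Rightarrow> bool" where
  "minimal_near \<epsilon> b0 x \<longleftrightarrow> (\<forall>b' x'. F b' x' \<longrightarrow>
     euclid_norm (b' - b0) < \<epsilon> \<longrightarrow> euclid_norm (x' - x) < \<epsilon> \<longrightarrow> objective y x \<le> objective y x')"

text \<open>\<open>tan\<close> is the linearized constraint at \<open>(b, x)\<close>. Its solution
  is lifted to a feasible curve, along which the objective changes to first order by
  \<open>- t ((y - x) \<bullet> v)\<close>; for small \<open>t > 0\<close> this cannot be a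
  decrease.\<close>

lemma tangent_le_0:
  assumes min: "minimal_near \<epsilon> b0 x" and b0: "b0 \<in> carrier_vec (q + 1)"
    and feas: "F b x" and near: "euclid_norm (b - b0) < \<epsilon>" and eps: "0 < \<epsilon>"
    and d: "d \<in> carrier_vec (q + 1)" "d \<bullet> e = 0" and v: "v \<in> carrier_vec N"
    and tan: "T d *\<^sub>v x + T b *\<^sub>v v = 0\<^sub>v (k + q)"
  shows "(y - x) \<bullet> v \<le> 0"
proof -
  have b: "b \<in> carrier_vec (q + 1)" and x: "x \<in> carrier_vec N"
    and Tx: "T b *\<^sub>v x = 0\<^sub>v (k + q)" and be: "b \<bullet> e = 1"
    using feas by (auto simp: feasible_iff)
  have b_nz: "b \<noteq> 0\<^sub>v (q + 1)" using normalized_nonzero[OF be] .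
  obtain u where u: "\<And>t. u t \<in> carrier_vec N"
    and lim: "\<And>j. j < N \<Longrightarrow> ((\<lambda>t. u t $ j) \<longlongrightarrow> v $ j) (at 0)"
    and ker: "eventually (\<lambda>t. (T b + t \<cdot>\<^sub>m T d) *\<^sub>v (x + t \<cdot>\<^sub>v u t) = 0\<^sub>v (k + q)) (at 0)"
    using pencil_kernel_curve[OF T[OF b] T[OF d(1)] transpose_T_injective[OF b b_nz] x v Tx tan] by blast
  have "((\<lambda>t. euclid_norm (b + t \<cdot>\<^sub>v d - b0)) \<longlongrightarrow> euclid_norm (b - b0)) (at 0)"
  proof (rule tendsto_euclid_norm)
    fix j assume "j < q + 1"
    moreover have "((\<lambda>t. b $ j + t * d $ j - b0 $ j) \<longlongrightarrow> b $ j + 0 * d $ j - b0 $ j) (at 0)"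
      by (intro tendsto_intros)
    ultimately show "((\<lambda>t. (b + t \<cdot>\<^sub>v d - b0) $ j) \<longlongrightarrow> (b - b0) $ j) (at 0)" using b b0 d by simp
  qed (use b b0 d in auto)
  then have near_b: "eventually (\<lambda>t. euclid_norm (b + t \<cdot>\<^sub>v d - b0) < \<epsilon>) (at 0)"
    using near by (rule order_tendstoD)
  have "((\<lambda>t. euclid_norm (x + t \<cdot>\<^sub>v u t - x)) \<longlongrightarrow> euclid_norm (0\<^sub>v N)) (at 0)"
  proof (rule tendsto_euclid_norm)
    fix j assume j: "j < N"
    have "((\<lambda>t. x $ j + t * u t $ j - x $ j) \<longlongrightarrow> x $ j + 0 * v $ j - x $ j) (at 0)"
      by (intro tendsto_intros lim j)
    then show "((\<lambda>t. (x + t \<cdot>\<^sub>v u t - x) $ j) \<longlongrightarrow> 0\<^sub>v N $ j) (at 0)"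
      using x carrier_vecD[OF u] j by simp
  qed (use x u in auto)
  moreover have "euclid_norm (0\<^sub>v N) = 0" by (simp add: euclid_norm_def)
  ultimately have near_x: "eventually (\<lambda>t. euclid_norm (x + t \<cdot>\<^sub>v u t - x) < \<epsilon>) (at 0)"
    using eps by (intro order_tendstoD) auto
  have "eventually (\<lambda>t. objective y x \<le> objective y (x + t \<cdot>\<^sub>v u t)) (at 0)"
    using ker near_b near_x
  proof eventually_elim
    case (elim t)
    have "(b + t \<cdot>\<^sub>v d) \<bullet> e = 1"
      using add_scalar_prod_distrib[OF b _ e, of "t \<cdot>\<^sub>v d"] d e be by simp
    then have "F (b + t \<cdot>\<^sub>v d) (x + t \<cdot>\<^sub>v u t)"
      unfolding feasible_iff T_add_smult[OF b d(1)] using elim(1) b d x u by simp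
    then show ?case using min elim(2,3) unfolding minimal_near_def by blast
  qed
  \<comment> \<open>Only \<open>t > 0\<close> is kept, so that dividing by \<open>t\<close>
    preserves the inequality before the limit is taken.\<close>
  then have "eventually (\<lambda>t. objective y x \<le> objective y (x + t \<cdot>\<^sub>v u t)) (at_right 0)"
    by (simp add: eventually_at_split)
  moreover have "eventually (\<lambda>t. t > 0) (at_right (0 :: real))" by (rule eventually_at_right_less)
  ultimately have "eventually (\<lambda>t. 0 \<le> t / 2 * (u t \<bullet> u t) - (y - x) \<bullet> u t) (at_right 0)"
  proof eventually_elim
    case (elim t)
    have "0 \<le> t * (t / 2 * (u t \<bullet> u t) - (y - x) \<bullet> u t)"
      using elim(1) unfolding objective_along[OF y x u] by (simp add: algebra_simps power2_eq_square)
    then show ?case using elim(2) by (simp add: zero_le_mult_iff)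
  qed
  moreover have "((\<lambda>t. t / 2 * (u t \<bullet> u t) - (y - x) \<bullet> u t) \<longlongrightarrow> 0 / 2 * (v \<bullet> v) - (y - x) \<bullet> v) (at_right 0)"
  proof -
    have lim': "((\<lambda>t. u t $ j) \<longlongrightarrow> v $ j) (at_right 0)" if "j < N" for j
      using lim[OF that] by (simp add: filterlim_at_split)
    have "y - x \<in> carrier_vec N" using y x by simp
    then show ?thesis
      using u v by (intro tendsto_intros tendsto_scalar_prod[of _ N] lim') auto
  qed
  ultimately have "0 \<le> 0 / 2 * (v \<bullet> v) - (y - x) \<bullet> v"
    by (intro tendsto_lowerbound) auto
  then show ?thesis by simp
qed

text \<open>Tangents may be scaled by -1, so the one-sided condition holds for both \<open>v\<close>
  and its negative.\<close>

lemma tangent_eq_0: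
  assumes min: "minimal_near \<epsilon> b0 x" and b0: "b0 \<in> carrier_vec (q + 1)"
    and feas: "F b x" and near: "euclid_norm (b - b0) < \<epsilon>" and eps: "0 < \<epsilon>"
    and d: "d \<in> carrier_vec (q + 1)" "d \<bullet> e = 0" and v: "v \<in> carrier_vec N"
    and tan: "G x *\<^sub>v d + T b *\<^sub>v v = 0\<^sub>v (k + q)"
  shows "(y - x) \<bullet> v = 0"
proof -
  have b: "b \<in> carrier_vec (q + 1)" and x: "x \<in> carrier_vec N" using feas by (auto simp: feasible_iff)
  have le: "(y - x) \<bullet> (s \<cdot>\<^sub>v v) \<le> 0" for s
  proof (rule tangent_le_0[OF min b0 feas near eps])
    show "s \<cdot>\<^sub>v d \<in> carrier_vec (q + 1)" "(s \<cdot>\<^sub>v d) \<bullet> e = 0" "s \<cdot>\<^sub>v v \<in> carrier_vec N"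
      using d e v by auto
    have Gd: "G x *\<^sub>v d \<in> carrier_vec (k + q)" using G d(1) by (rule mult_mat_vec_carrier)
    have Tv: "T b *\<^sub>v v \<in> carrier_vec (k + q)" using T[OF b] v by (rule mult_mat_vec_carrier)
    have "T (s \<cdot>\<^sub>v d) *\<^sub>v x + T b *\<^sub>v (s \<cdot>\<^sub>v v) = s \<cdot>\<^sub>v (G x *\<^sub>v d) + s \<cdot>\<^sub>v (T b *\<^sub>v v)"
      using G_mult[of "s \<cdot>\<^sub>v d" x] mult_mat_vec[OF G d(1)] mult_mat_vec[OF T[OF b] v] d(1) x by simp
    also have "\<dots> = s \<cdot>\<^sub>v (G x *\<^sub>v d + T b *\<^sub>v v)"
      using smult_add_distrib_vec[OF Gd Tv] by simp
    finally show "T (s \<cdot>\<^sub>v d) *\<^sub>v x + T b *\<^sub>v (s \<cdot>\<^sub>v v) = 0\<^sub>v (k + q)" unfolding tan by auto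
  qed
  have "(y - x) \<bullet> (s \<cdot>\<^sub>v v) = s * ((y - x) \<bullet> v)" for s
    using x y v by simp
  then show ?thesis using le[of 1] le[of "-1"] by simp
qed

text \<open>Tangents with \<open>d = 0\<close> put \<open>y - x\<close> into the range of
  \<open>(T b)\<^sup>T\<close>; those with \<open>d\<close> orthogonal to \<open>e\<close> show
  \<open>G\<^sup>T l\<close> orthogonal to \<open>d\<close>. The remaining direction
  \<open>b\<close> is harmless because \<open>G x b = 0\<close>.\<close>

lemma minimal_near_imp_multiplier:
  assumes min: "minimal_near \<epsilon> b0 x" and b0: "b0 \<in> carrier_vec (q + 1)"
    and feas: "F b x" and near: "euclid_norm (b - b0) < \<epsilon>" and eps: "0 < \<epsilon>"
  obtains l where "l \<in> carrier_vec (k + q)" "y - x = (T b)\<^sup>T *\<^sub>v l" "(G x)\<^sup>T *\<^sub>v l = 0\<^sub>v (q + 1)"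
proof -
  have b: "b \<in> carrier_vec (q + 1)" and x: "x \<in> carrier_vec N"
    and Tx: "T b *\<^sub>v x = 0\<^sub>v (k + q)" and be: "b \<bullet> e = 1"
    using feas by (auto simp: feasible_iff)
  have b_nz: "b \<noteq> 0\<^sub>v (q + 1)" using normalized_nonzero[OF be] .
  have yx: "y - x \<in> carrier_vec N" using y x by simp
  have tangent: "(y - x) \<bullet> v = 0"
    if "d \<in> carrier_vec (q + 1)" "d \<bullet> e = 0" "v \<in> carrier_vec N"
      "G x *\<^sub>v d + T b *\<^sub>v v = 0\<^sub>v (k + q)" for d v
    using tangent_eq_0[OF min b0 feas near eps] that by blast
  have "(y - x) \<bullet> v = 0" if v: "v \<in> carrier_vec N" "T b *\<^sub>v v = 0\<^sub>v (k + q)" for v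
  proof (rule tangent[OF _ _ v(1)])
    have "G x *\<^sub>v 0\<^sub>v (q + 1) = 0\<^sub>v (k + q)" using G[of x] by auto
    then show "G x *\<^sub>v 0\<^sub>v (q + 1) + T b *\<^sub>v v = 0\<^sub>v (k + q)" using v(2) by simp
  qed (use e in auto)
  then obtain l where l: "l \<in> carrier_vec (k + q)" "y - x = (T b)\<^sup>T *\<^sub>v l"
    using orthogonal_kernel_imp_range_transpose[OF T[OF b] transpose_T_injective[OF b b_nz] yx] by blast
  have GT: "(G x)\<^sup>T *\<^sub>v l \<in> carrier_vec (q + 1)" using G[of x] l(1) by simp
  have lG: "l \<bullet> (G x *\<^sub>v d) = 0" if d: "d \<in> carrier_vec (q + 1)" "d \<bullet> e = 0" for d
  proof -
    have Gd: "G x *\<^sub>v d \<in> carrier_vec (k + q)" using G d(1) by (rule mult_mat_vec_carrier)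
    have TT: "T b * (T b)\<^sup>T \<in> carrier_mat (k + q) (k + q)"
      using T[OF b] by (intro mult_carrier_mat[of _ _ N]) auto
    have TbT: "(T b)\<^sup>T \<in> carrier_mat N (k + q)" using T[OF b] by simp
    \<comment> \<open>Surjectivity of the Gram matrix completes every admissible \<open>d\<close> to
      a tangent \<open>(d, v)\<close> with \<open>v\<close> in the range of
      \<open>(T b)\<^sup>T\<close>.\<close>
    obtain s where s: "s \<in> carrier_vec (k + q)" "(T b * (T b)\<^sup>T) *\<^sub>v s = - (G x *\<^sub>v d)"
      using injective_square_mat_solvable[OF TT, of "- (G x *\<^sub>v d)"]
        gram_injective[OF T[OF b] transpose_T_injective[OF b b_nz]] Gd
      by (metis uminus_carrier_vec)
    define v where "v = (T b)\<^sup>T *\<^sub>v s"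
    have v: "v \<in> carrier_vec N" unfolding v_def using TbT s(1) by (rule mult_mat_vec_carrier)
    have Tv: "T b *\<^sub>v v = - (G x *\<^sub>v d)"
      unfolding v_def using assoc_mult_mat_vec[OF T[OF b] TbT s(1)] s(2) by simp
    have "(y - x) \<bullet> v = 0" using Gd Tv by (intro tangent[OF d v]) simp
    then have "l \<bullet> (T b *\<^sub>v v) = 0"
      using scalar_prod_mult_mat_vec[OF T[OF b] l(1) v] l(2) by simp
    moreover have "dim_vec (G x *\<^sub>v d) = dim_vec l"
      unfolding carrier_vecD[OF Gd] carrier_vecD[OF l(1)] ..
    ultimately show ?thesis unfolding Tv using scalar_prod_uminus_right by fastforce
  qed
  have "(G x)\<^sup>T *\<^sub>v l = 0\<^sub>v (q + 1)"
  proof (rule eq_0_if_orthogonal[OF GT])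
    fix g :: "real vec" assume g: "g \<in> carrier_vec (q + 1)"
    \<comment> \<open>As \<open>b \<bullet> e = 1\<close>, this projects along \<open>b\<close> onto
      the complement of \<open>e\<close>, without changing the image under
      \<open>G x\<close>.\<close>
    define d where "d = g - (g \<bullet> e) \<cdot>\<^sub>v b"
    have d: "d \<in> carrier_vec (q + 1)" using g b by (simp add: d_def)
    have "d \<bullet> e = 0"
      unfolding d_def using minus_scalar_prod_distrib[OF g _ e, of "(g \<bullet> e) \<cdot>\<^sub>v b"] b e be by simp
    have "G x *\<^sub>v d = G x *\<^sub>v g - G x *\<^sub>v ((g \<bullet> e) \<cdot>\<^sub>v b)"
      unfolding d_def using G g b by (intro mult_minus_distrib_mat_vec) auto
    also have "G x *\<^sub>v ((g \<bullet> e) \<cdot>\<^sub>v b) = 0\<^sub>v (k + q)"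
      unfolding mult_mat_vec[OF G b] G_mult[OF b x] Tx by auto
    also have "G x *\<^sub>v g - 0\<^sub>v (k + q) = G x *\<^sub>v g"
      using mult_mat_vec_carrier[OF G g] by simp
    finally have "l \<bullet> (G x *\<^sub>v g) = 0" using lG[OF d \<open>d \<bullet> e = 0\<close>] by simp
    then show "((G x)\<^sup>T *\<^sub>v l) \<bullet> g = 0"
      using scalar_prod_mult_mat_vec[OF G l(1) g] by simp
  qed
  then show thesis using that l by blast
qed

text \<open>Both sides of the linear system vanish for \<open>w = 0\<close>.\<close>

lemma exact_fit_is_eigenvalue:
  assumes "F b y"
  shows "real_affine_eigenvalue N n m c y e b"
proof -
  have b: "b \<in> carrier_vec (q + 1)" "b \<bullet> e = 1" "T b *\<^sub>v y = 0\<^sub>v (k + q)"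
    using assms by (auto simp: feasible_iff)
  have mult_zero: "M *\<^sub>v 0\<^sub>v j = 0\<^sub>v i" if "M \<in> carrier_mat i j" for M :: "real mat" and i j
    using that by auto
  have "T b * (T b)\<^sup>T \<in> carrier_mat (k + q) (k + q)"
    using T[OF b(1)] by (intro mult_carrier_mat[of _ _ N]) auto
  moreover have "(B b)\<^sup>T \<in> carrier_mat (k + q) k" using B[OF b(1)] by simp
  ultimately have "T b *\<^sub>v y = (T b * (T b)\<^sup>T) *\<^sub>v ((B b)\<^sup>T *\<^sub>v 0\<^sub>v k)"
    by (simp only: mult_zero b(3))
  then show ?thesis unfolding eigenvalue_iff using b zero_carrier_vec[of k] by blast
qed

lemma local_minimizer_imp_eigenvalue:
  assumes "local_minimizer N n m c y e b x"
  shows "real_affine_eigenvalue N n m c y e b"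
proof -
  obtain \<epsilon> where feas: "F b x" and eps: "0 < \<epsilon>" and min: "minimal_near \<epsilon> b x"
    using assms unfolding local_minimizer_def minimal_near_def by blast
  have b: "b \<in> carrier_vec (q + 1)" and x: "x \<in> carrier_vec N"
    and Tx: "T b *\<^sub>v x = 0\<^sub>v (k + q)" and be: "b \<bullet> e = 1"
    using feas by (auto simp: feasible_iff)
  have b_nz: "b \<noteq> 0\<^sub>v (q + 1)" using normalized_nonzero[OF be] .
  have "euclid_norm (b - b) = 0" using b by (simp add: euclid_norm_def)
  then have near: "euclid_norm (b - b) < \<epsilon>" using eps by simp
  show ?thesis
  proof (cases "\<forall>g \<in> carrier_vec (q + 1). G x *\<^sub>v g = 0\<^sub>v (k + q) \<longrightarrow> (\<exists>s. g = s \<cdot>\<^sub>v b)")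
    case True
    obtain l where l: "l \<in> carrier_vec (k + q)" "y - x = (T b)\<^sup>T *\<^sub>v l" "(G x)\<^sup>T *\<^sub>v l = 0\<^sub>v (q + 1)"
      using minimal_near_imp_multiplier[OF min b feas near eps] .
    have "\<exists>w. w \<in> carrier_vec k \<and> l = (B b)\<^sup>T *\<^sub>v w"
      using left_kernel_imp_range_transpose[OF B[OF b] G transpose_toeplitz_injective[OF b b_nz]
          B_G_mult[OF b x Tx] b b_nz _ l(1,3)] True by blast
    then obtain w where w: "w \<in> carrier_vec k" "l = (B b)\<^sup>T *\<^sub>v w" by blast
    have Ty: "T b *\<^sub>v y \<in> carrier_vec (k + q)" using T[OF b] y by (rule mult_mat_vec_carrier)
    have "(T b * (T b)\<^sup>T) *\<^sub>v l = T b *\<^sub>v (y - x)"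
      unfolding l(2) using T[OF b] l(1) by (intro assoc_mult_mat_vec) auto
    also have "\<dots> = T b *\<^sub>v y - T b *\<^sub>v x"
      using T[OF b] y x by (rule mult_minus_distrib_mat_vec)
    also have "\<dots> = T b *\<^sub>v y" unfolding Tx using Ty by simp
    finally have "T b *\<^sub>v y = (T b * (T b)\<^sup>T) *\<^sub>v ((B b)\<^sup>T *\<^sub>v w)"
      unfolding w(2) by (rule sym)
    then show ?thesis unfolding eigenvalue_iff using b be w(1) by blast
  next
    case False
    then obtain g where g: "g \<in> carrier_vec (q + 1)" "G x *\<^sub>v g = 0\<^sub>v (k + q)"
      and g_indep: "\<And>s. g \<noteq> s \<cdot>\<^sub>v b" by blast
    \<comment> \<open>Subtracting the component along \<open>b\<close> keeps \<open>d\<close> in the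
      kernel of \<open>G x\<close> and makes it orthogonal to \<open>e\<close>; so
      \<open>b + t d\<close> stays feasible with the same \<open>x\<close>.\<close>
    define d where "d = g - (g \<bullet> e) \<cdot>\<^sub>v b"
    have d: "d \<in> carrier_vec (q + 1)" using g b by (simp add: d_def)
    have de: "d \<bullet> e = 0"
      unfolding d_def using minus_scalar_prod_distrib[OF g(1) _ e, of "(g \<bullet> e) \<cdot>\<^sub>v b"] b e be by simp
    have d_nz: "d \<noteq> 0\<^sub>v (q + 1)"
    proof
      assume "d = 0\<^sub>v (q + 1)"
      then have "g = (g \<bullet> e) \<cdot>\<^sub>v b" using g(1) b unfolding d_def by (auto simp: vec_eq_iff)
      then show False using g_indep by blast
    qed
    have "G x *\<^sub>v d = G x *\<^sub>v g - G x *\<^sub>v ((g \<bullet> e) \<cdot>\<^sub>v b)"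
      unfolding d_def using G g b by (intro mult_minus_distrib_mat_vec) auto
    also have "\<dots> = 0\<^sub>v (k + q)"
      unfolding mult_mat_vec[OF G b] G_mult[OF b x] Tx g(2) by auto
    finally have Gd: "G x *\<^sub>v d = 0\<^sub>v (k + q)" .
    have carrier: "b + t \<cdot>\<^sub>v d \<in> carrier_vec (q + 1)" for t using b d by simp
    have norm1: "(b + t \<cdot>\<^sub>v d) \<bullet> e = 1" for t
      using add_scalar_prod_distrib[OF b _ e, of "t \<cdot>\<^sub>v d"] d de e be by simp
    have feas': "F (b + t \<cdot>\<^sub>v d) x" for t
    proof -
      have "T (b + t \<cdot>\<^sub>v d) *\<^sub>v x = G x *\<^sub>v b + t \<cdot>\<^sub>v (G x *\<^sub>v d)"
        unfolding G_mult[OF carrier x, symmetric]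
        using mult_add_distrib_mat_vec[OF G b, of "t \<cdot>\<^sub>v d"] mult_mat_vec[OF G d] d by simp
      also have "\<dots> = 0\<^sub>v (k + q)" unfolding Gd G_mult[OF b x] Tx by auto
      finally show ?thesis unfolding feasible_iff using carrier norm1 x by blast
    qed
    have "((\<lambda>t. euclid_norm (b + t \<cdot>\<^sub>v d - b)) \<longlongrightarrow> euclid_norm (b - b)) (at 0)"
    proof (rule tendsto_euclid_norm)
      fix j assume "j < q + 1"
      moreover have "((\<lambda>t. b $ j + t * d $ j - b $ j) \<longlongrightarrow> b $ j + 0 * d $ j - b $ j) (at 0)"
        by (intro tendsto_intros)
      ultimately show "((\<lambda>t. (b + t \<cdot>\<^sub>v d - b) $ j) \<longlongrightarrow> (b - b) $ j) (at 0)" using b d by simp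
    qed (use b d in auto)
    then have "eventually (\<lambda>t. euclid_norm (b + t \<cdot>\<^sub>v d - b) < \<epsilon>) (at 0)"
      using near by (rule order_tendstoD)
    then obtain \<delta> where \<delta>: "0 < \<delta>" "\<And>t. t \<noteq> 0 \<Longrightarrow> \<bar>t\<bar> < \<delta> \<Longrightarrow> euclid_norm (b + t \<cdot>\<^sub>v d - b) < \<epsilon>"
      unfolding eventually_at by (auto simp: dist_real_def)
    have "vec_poly (y - x) = 0"
    proof (rule pencil_common_multiple_eq_0)
      show "infinite {0<..<\<delta>}" using \<delta>(1) by simp
    next
      fix t assume "t \<in> {0<..<\<delta>}"
      then have "euclid_norm (b + t \<cdot>\<^sub>v d - b) < \<epsilon>" using \<delta>(2) by simp
      \<comment> \<open>The multiplier at \<open>b + t d\<close> is available because minimality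
        near the centre \<open>b\<close> also covers this feasible point; it exhibits the polynomial
        of \<open>b + t d\<close> as a factor.\<close>
      then obtain l where "l \<in> carrier_vec (k + q)" "y - x = (T (b + t \<cdot>\<^sub>v d))\<^sup>T *\<^sub>v l"
        using minimal_near_imp_multiplier[OF min b feas' _ eps] by blast
      then have "vec_poly (y - x) = vec_poly l * vec_poly c * vec_poly (b + t \<cdot>\<^sub>v d)"
        using vec_poly_transpose_T[OF carrier] by simp
      moreover have "vec_poly (b + t \<cdot>\<^sub>v d) = vec_poly b + Polynomial.smult t (vec_poly d)"
        using b d by (intro vec_poly_add_smult) simp
      ultimately show "vec_poly b + Polynomial.smult t (vec_poly d) dvd vec_poly (y - x)" by simp
    next
      fix s t t' :: real
      assume eq: "vec_poly b + Polynomial.smult t' (vec_poly d)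
        = Polynomial.smult s (vec_poly b + Polynomial.smult t (vec_poly d))"
      have i: "b $ i + t' * d $ i = s * (b $ i + t * d $ i)" if "i < q + 1" for i
        using arg_cong[OF eq, of "\<lambda>p. coeff p i"] b d that by (simp add: coeff_vec_poly)
      then have eq': "b + t' \<cdot>\<^sub>v d = s \<cdot>\<^sub>v (b + t \<cdot>\<^sub>v d)" using b d by (intro eq_vecI) auto
      \<comment> \<open>Pairing with \<open>e\<close> gives 1 for both members of the pencil, so the
        scalar is 1; a nonzero entry of \<open>d\<close> then identifies the parameters.\<close>
      have "s = 1" using norm1[of t'] norm1[of t] carrier[of t] e unfolding eq' by simp
      obtain i where "i < q + 1" "d $ i \<noteq> 0" using d d_nz by (auto simp: vec_eq_iff)
      then show "t = t'" using i[of i] \<open>s = 1\<close> by simp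
    qed
    then have "y - x = 0\<^sub>v N" using x by (simp add: vec_poly_eq_0_iff)
    then have "x = y" using x y by (auto simp: vec_eq_iff)
    then show ?thesis using exact_fit_is_eigenvalue feas by simp
  qed
qed

end

theorem theorem1:
  fixes N n m :: nat
    and y e :: "real vec"
    and p :: "nat \<Rightarrow> complex"
  assumes "m < n" and "2 * n < N"
    and "y \<in> carrier_vec N"
    and "\<And>k. coeff (pole_poly m p) k \<in> \<real>"
    and "e \<in> carrier_vec (n - m + 1)" and "e \<noteq> 0\<^sub>v (n - m + 1)"
  shows "(\<forall>b. real_affine_eigenvalue N n m (pole_coeffs m p) y e b \<longrightarrow>
             (\<exists>yh lam mu. critical_point N n m (pole_coeffs m p) y e b yh lam mu)) \<and>
         (\<forall>b yh. local_minimizer N n m (pole_coeffs m p) y e b yh \<longrightarrow>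
             real_affine_eigenvalue N n m (pole_coeffs m p) y e b)"
proof -
  \<comment> \<open>The assumptions \<open>m < n\<close> and \<open>2 * n < N\<close> make these
    natural-number differences exact.\<close>
  interpret fixed_pole_realization N n m "n - m" "N - 2 * n + m" "pole_coeffs m p" y e
    using assms pole_coeffs_carrier pole_coeffs_nonzero by unfold_locales auto
  show ?thesis
    using eigenvalue_imp_critical_point local_minimizer_imp_eigenvalue by blast
qed

end
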